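(* For each positive integer $n$, let $M_n$ be a random matrix chosen uniformly from the set of all $n\times n$ symmetric matrices with entries in $\{-1,+1\}$, and let $p(n)=\Pr[M_n \text{ is singular}]$. There exists a constant $C>0$ such that $$p(n)=O\left(\frac{\log^{C} n}{n^{1/2}}\right)\quad\text{as } n\to\infty.$$
   Context: Singular means singular as a real matrix (determinant zero). Equivalently to the uniform choice, the entries $m_{ij}$ with $1\le i\le j\le n$ are independent uniform $\pm1$ random variables and $m_{ji}=m_{ij}$. Here $\log^{C} n$ means $(\log n)^{C}$. *)

theory Defs
  imports
    "HOL-Probability.Probability_Mass_Function"
    "HOL-Library.Landau_Symbols"
    "Jordan_Normal_Form.Determinant"
begin

definition sym_sign_mats :: "nat \<Rightarrow> real mat set" where
  "sym_sign_mats n =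
     {A \<in> carrier_mat n n. transpose_mat A = A \<and> (\<forall>i<n. \<forall>j<n. A $$ (i, j) \<in> {-1, 1})}"

text \<open>
  \<^const>\<open>pmf_of_set\<close> is the uniform distribution only for finite nonempty sets.
\<close>

lemma finite_sym_sign_mats: "finite (sym_sign_mats n)"
proof (rule finite_subset)
  show "sym_sign_mats n \<subseteq>
      (\<lambda>f. Matrix.mat n n f) ` ({..<n} \<times> {..<n} \<rightarrow>\<^sub>E {-1, 1})"
  proof
    fix A assume "A \<in> sym_sign_mats n"
    then have A: "A \<in> carrier_mat n n" and e: "\<forall>i<n. \<forall>j<n. A $$ (i, j) \<in> {-1, 1}"
      by (auto simp: sym_sign_mats_def)
    let ?f = "restrict (\<lambda>ij. A $$ ij) ({..<n} \<times> {..<n})"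
    have "A = Matrix.mat n n ?f"
      using A by (intro eq_matI) auto
    moreover have "?f \<in> {..<n} \<times> {..<n} \<rightarrow>\<^sub>E {-1, 1}"
      using e by (intro restrict_PiE_iff[THEN iffD2]) auto
    ultimately show "A \<in> (\<lambda>f. Matrix.mat n n f) ` ({..<n} \<times> {..<n} \<rightarrow>\<^sub>E {-1, 1})"
      by blast
  qed
qed (intro finite_imageI finite_PiE, auto)

lemma sym_sign_mats_nonempty: "sym_sign_mats n \<noteq> {}"
proof -
  have "Matrix.mat n n (\<lambda>_. 1) \<in> sym_sign_mats n"
    by (auto simp: sym_sign_mats_def intro!: eq_matI)
  then show ?thesis by blast
qed

text \<open>
  The determinant is the one for matrices whose size is a value, not the one of
  \<^theory>\<open>HOL-Analysis.Determinants\<close>, where the size is a type.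
\<close>

definition singular_prob :: "nat \<Rightarrow> real" where
  "singular_prob n =
     measure_pmf.prob (pmf_of_set (sym_sign_mats n)) {A. Determinant.det A = 0}"

end

theory Submission
  imports Defs "HOL-Real_Asymp.Real_Asymp" "HOL-Number_Theory.Cong"
begin

text \<open>
  Fix a prime \<open>n < p \<le> n\<^sup>2\<close> and work modulo \<open>p\<close>. If \<open>M v = 0\<close> with \<open>v i\<close> nonzero, then after
  deleting row and column \<open>i\<close> the deleted column \<open>x\<close> satisfies a quadratic equation determined by the
  remaining matrix \<open>B\<close>. Resampling the signs of \<open>x\<close> on a set \<open>J\<close> of about \<open>log n\<close> coordinates
  decouples it (Cauchy-Schwarz, hence the exponent 1/2): the condition becomes linear in the other signs, with
  a coefficient vector \<open>w\<close> such that \<open>B w\<close> vanishes outside \<open>J\<close>. So it suffices that, with high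
  probability, every nonzero such \<open>w\<close> has many nonzero coordinates and concentration probability
  at most \<open>polylog n / n\<close>; the first property lets one average over \<open>i\<close>.

  This follows from a union bound. A vector with \<open>s = n / log\<^sup>2 n\<close> coordinates
  among which no value is taken more than \<open>t = \<surd>n log\<^sup>3 n\<close> times has concentration at most
  \<open>polylog n / n\<close> by Halasz's argument with pairs. All other vectors take, off \<open>s\<close> coordinates, at most
  \<open>n / t\<close> values, so there are at most \<open>(n / t)\<^sup>n e\<^bsup>o(n)\<^esup>\<close> of them, while each satisfies the
  equations with probability at most \<open>(polylog n / \<surd>n)\<^bsup>n - o(n)\<^esup>\<close> by the Littlewood-Offord
  bound (and \<open>(3/4)\<^bsup>n - o(n)\<^esup>\<close> if it has few nonzero coordinates).
\<close>

section \<open>Primes between \<open>n\<close> and \<open>n\<^sup>2\<close>\<close>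

text \<open>Induction along the Leibniz harmonic triangle, whose entries are \<open>1 / (Suc n * (n choose k))\<close>.\<close>

lemma Suc_times_binomial_dvd_Lcm:
  assumes "k \<le> n"
  shows "Suc n * (n choose k) dvd Lcm {1..Suc n}"
  using assms
proof (induction k arbitrary: n)
  case 0
  then show ?case by (simp add: dvd_Lcm)
next
  case (Suc k)
  then obtain m where n: "n = Suc m" "k \<le> m" by (cases n) auto
  let ?D = "Lcm {1..Suc (Suc m)} :: nat"
  have "Lcm {1..Suc m} dvd ?D" by (rule Lcm_subset) auto
  with Suc.IH[OF n(2)] have 1: "Suc m * (m choose k) dvd ?D" by (rule dvd_trans)
  have 2: "Suc (Suc m) * (Suc m choose k) dvd ?D" using n(2) by (intro Suc.IH) auto
  \<comment> \<open>The harmonic triangle recurrence multiplied by \<open>?D\<close>: the entries at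
    \<open>(m, k)\<close> and \<open>(Suc m, k)\<close> become \<open>a\<close> and
    \<open>b\<close>, and the entry at \<open>(Suc m, Suc k)\<close> is their difference, so
    \<open>a - b\<close> is the wanted cofactor.\<close>
  obtain a b where a: "?D = Suc m * (m choose k) * a" and b: "?D = Suc (Suc m) * (Suc m choose k) * b"
    using 1 2 unfolding dvd_def by blast
  define r where "r = real (m choose k)"
  have r: "r > 0" using n(2) by (simp add: r_def)
  define d where "d = real m - real k"
  have d: "d \<ge> 0" using n(2) by (simp add: d_def)
  have c1: "real (Suc m choose k) * (d + 1) = (real m + 1) * r"
  proof -
    have "(Suc m choose k) * (Suc m - k) = Suc m * (m choose k)"
      using binomial_absorb_comp[of "Suc m" k] by (simp add: mult.commute)
    then have "real (Suc m choose k) * real (Suc m - k) = real (Suc m) * r"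
      unfolding r_def by (metis of_nat_mult)
    then show ?thesis using n(2) by (simp add: d_def of_nat_diff algebra_simps)
  qed
  have c2: "real (Suc m choose Suc k) * (real k + 1) = (real m + 1) * r"
  proof -
    have "Suc k * (Suc m choose Suc k) = Suc m * (m choose k)"
      by (rule Suc_times_binomial)
    then have "real (Suc k) * real (Suc m choose Suc k) = real (Suc m) * r"
      unfolding r_def by (metis of_nat_mult)
    then show ?thesis by (simp add: algebra_simps)
  qed
  have D: "real ?D = (real m + 1) * r * real a"
    unfolding a r_def by (simp add: algebra_simps)
  have D': "real ?D * (d + 1) = (real m + 2) * ((real m + 1) * r) * real b"
    unfolding b c1[symmetric] by (simp add: algebra_simps)
  have m2: "real m + 2 = (d + 1) + (real k + 1)" by (simp add: d_def)
  have bb: "real a * (d + 1) = (real m + 2) * real b"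
  proof -
    have "((real m + 1) * r) * (real a * (d + 1)) = ((real m + 1) * r) * ((real m + 2) * real b)"
      using D D' by (simp add: algebra_simps)
    then show ?thesis using r by simp
  qed
  have "a \<ge> b"
  proof -
    have "real b * (d + 1) \<le> real a * (d + 1)" unfolding bb using d
      by (simp add: m2 algebra_simps)
    then show ?thesis using d by simp
  qed
  have "(real m + 2) * real (Suc m choose Suc k) * (real a - real b) * (real k + 1)
      = ((real m + 1) * r) * ((real m + 2) * real a - (real m + 2) * real b)"
  proof -
    have "(real m + 2) * X * (real a - real b) * (real k + 1)
      = (X * (real k + 1)) * ((real m + 2) * real a - (real m + 2) * real b)" for X
      by (simp add: algebra_simps)
    then show ?thesis unfolding c2[symmetric] .
  qed
  also have "\<dots> = ((real m + 1) * r) * real a * (real k + 1)"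
    unfolding bb[symmetric] by (simp add: m2 algebra_simps)
  also have "\<dots> = real ?D * (real k + 1)" using D by simp
  finally have eq: "(real m + 2) * real (Suc m choose Suc k) * (real a - real b) = real ?D"
    by (simp add: add_nonneg_eq_0_iff)
  have "real ?D = real (Suc (Suc m) * (Suc m choose Suc k) * (a - b))"
  proof -
    have "real (Suc (Suc m)) = real m + 2" by simp
    then show ?thesis using eq[symmetric] \<open>a \<ge> b\<close> by (simp only: of_nat_mult of_nat_diff)
  qed
  then have "?D = Suc (Suc m) * (Suc m choose Suc k) * (a - b)" by (simp only: of_nat_eq_iff)
  then show ?case unfolding n by (metis dvd_triv_left)
qed

text \<open>Each prime contributes to the lcm its highest power dividing some element of
  \<open>{1..N}\<close>, and that power is at most \<open>N\<close>.\<close>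

lemma Lcm_atLeastAtMost_le:
  fixes N :: nat
  shows "Lcm {1..N} \<le> N ^ card {p. prime p \<and> p \<le> N}"
proof (cases "N = 0")
  case False
  let ?P = "{p::nat. prime p \<and> p \<le> N}"
  have fin: "finite ?P" by (rule finite_subset[of _ "{..N}"]) auto
  define e where "e p = Max (multiplicity p ` {1..N})" for p
  have "Lcm {1..N} dvd (\<Prod>p\<in>?P. p ^ e p)"
  proof (rule Lcm_least)
    fix x assume x: "x \<in> {1..N}"
    then have "x = (\<Prod>p\<in>prime_factors x. p ^ multiplicity p x)"
      by (intro prime_factorization_nat) auto
    also have "\<dots> dvd (\<Prod>p\<in>prime_factors x. p ^ e p)"
      using x by (intro prod_dvd_prod le_imp_power_dvd) (auto simp: e_def intro!: Max_ge)
    also have "\<dots> dvd (\<Prod>p\<in>?P. p ^ e p)"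
      using x fin by (intro prod_dvd_prod_subset) (auto simp: prime_factors_dvd dest: dvd_imp_le)
    finally show "x dvd (\<Prod>p\<in>?P. p ^ e p)" .
  qed
  moreover have "(\<Prod>p\<in>?P. p ^ e p) > 0" using fin by (intro prod_pos) (auto simp: prime_gt_0_nat)
  ultimately have "Lcm {1..N} \<le> (\<Prod>p\<in>?P. p ^ e p)" by (intro dvd_imp_le)
  also have "\<dots> \<le> (\<Prod>p\<in>?P. N)"
  proof (intro prod_mono conjI)
    fix p assume p: "p \<in> ?P"
    have "e p \<in> multiplicity p ` {1..N}" unfolding e_def using False by (intro Max_in) auto
    then obtain x where x: "x \<in> {1..N}" "e p = multiplicity p x" by auto
    have "p ^ e p dvd x" unfolding x by (rule multiplicity_dvd)
    then show "p ^ e p \<le> N" using x by (auto dest: dvd_imp_le)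
  qed auto
  finally show ?thesis by simp
next
  case True
  then have "{p::nat. prime p \<and> p \<le> N} = {}" by (auto dest: prime_gt_0_nat)
  then have "card {p. prime p \<and> p \<le> N} = 0" by (simp only: card.empty)
  then show ?thesis using True by (simp only: power_0) simp
qed

text \<open>Chebyshev's argument: the lcm of \<open>{1..2 * m + 1}\<close>, with
  \<open>2 * m + 1\<close> the largest odd number up to \<open>n ^ 2\<close>, is at least
  \<open>4 ^ m\<close>. Without a prime in the gap at most \<open>n\<close> primes would contribute
  to it, so it would be at most \<open>n ^ (2 * n)\<close>, which is too small for large
  \<open>n\<close>.\<close>

lemma eventually_prime_between_power2:
  "\<forall>\<^sub>F n::nat in sequentially. \<exists>p. prime p \<and> n < p \<and> p \<le> n ^ 2"
proof -
  have "\<forall>\<^sub>F n::nat in sequentially. 2 * real n * ln n < (real n ^ 2 - 2) * ln 2" by real_asymp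
  moreover have "\<forall>\<^sub>F n::nat in sequentially. n \<ge> 3" by (rule eventually_ge_at_top)
  ultimately show ?thesis
  proof eventually_elim
    case (elim n)
    show ?case
    proof (rule ccontr)
      assume neg: "\<not> ?thesis"
      define m where "m = (n ^ 2 - 1) div 2"
      have n9: "n ^ 2 \<ge> 9" using elim(2) power_mono[of 3 n 2] by simp
      have m: "2 * m + 1 \<le> n ^ 2" "n ^ 2 \<le> 2 * m + 2" "m > 0" using n9 unfolding m_def by linarith+
      have "{p. prime p \<and> p \<le> 2 * m + 1} \<subseteq> {1..n}"
      proof
        fix p assume p: "p \<in> {p. prime p \<and> p \<le> 2 * m + 1}"
        then have "prime p" "p \<le> n ^ 2" using m(1) by auto
        then show "p \<in> {1..n}" using neg prime_ge_1_nat[of p] by (auto simp: not_less)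
      qed
      then have c: "card {p. prime p \<and> p \<le> 2 * m + 1} \<le> n"
        using card_mono[of "{1..n}"] by fastforce
      have "4 ^ m \<le> 2 * m * (2 * m choose m)"
      proof -
        have "4 ^ m / (2 * real m) \<le> real (2 * m choose m)"
          using central_binomial_lower_bound[OF m(3)] by simp
        then have "(4::real) ^ m \<le> 2 * real m * real (2 * m choose m)"
          using m(3) by (simp add: field_simps)
        then have "real (4 ^ m) \<le> real (2 * m * (2 * m choose m))" by simp
        then show ?thesis by (simp only: of_nat_le_iff)
      qed
      also have "\<dots> \<le> Suc (2 * m) * (2 * m choose m)" by simp
      also have "\<dots> \<le> Lcm {1..Suc (2 * m)}"
        by (intro dvd_imp_le Suc_times_binomial_dvd_Lcm) (use m(3) in \<open>auto simp: Lcm_0_iff intro!: Nat.gr0I\<close>)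
      also have "\<dots> \<le> (2 * m + 1) ^ card {p. prime p \<and> p \<le> 2 * m + 1}"
        using Lcm_atLeastAtMost_le[of "2 * m + 1"] by simp
      also have "\<dots> \<le> (2 * m + 1) ^ n" by (intro power_increasing c) auto
      also have "\<dots> \<le> (n ^ 2) ^ n" by (intro power_mono m) auto
      finally have "real (4 ^ m) \<le> real ((n ^ 2) ^ n)" by (simp only: of_nat_le_iff)
      then have "ln ((4::real) ^ m) \<le> ln (real n ^ (2 * n))"
        using elim(2) by (subst ln_le_cancel_iff) (auto simp: power_mult)
      then have "m * ln (2 ^ 2::real) \<le> 2 * n * ln n" using elim(2) by (simp add: ln_realpow)
      then have "2 * real m * ln 2 \<le> 2 * n * ln n" by (subst (asm) ln_realpow) auto
      moreover have "(real n ^ 2 - 2) * ln 2 \<le> (2 * real m) * ln 2"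
      proof -
        have "real (n ^ 2) \<le> real (2 * m + 2)" using m(2) by (simp only: of_nat_le_iff)
        then show ?thesis by (intro mult_right_mono) auto
      qed
      ultimately show False using elim(1) by linarith
    qed
  qed
qed

section \<open>Concentration of signed sums modulo a prime\<close>

text \<open>The mean over all frequencies modulo \<open>p\<close> of the modulus of the
  characteristic function of the randomly signed sum of the \<open>w j\<close>. It dominates the
  concentration probability and replaces it throughout, being antitone in \<open>C\<close> and blind
  to the signs of the coefficients.\<close>

definition fourier_bound :: "nat \<Rightarrow> nat set \<Rightarrow> (nat \<Rightarrow> int) \<Rightarrow> real" where
  "fourier_bound p C w =
     (\<Sum>\<xi>\<in>{0..<int p}. \<Prod>j\<in>C. \<bar>cos (2 * pi * of_int \<xi> * of_int (w j) / p)\<bar>) / p"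

lemma fourier_bound_nonneg: "fourier_bound p C w \<ge> 0"
  unfolding fourier_bound_def by (intro divide_nonneg_nonneg sum_nonneg prod_nonneg) auto

lemma fourier_bound_antimono:
  assumes "C \<subseteq> C'" "finite C'"
  shows "fourier_bound p C' w \<le> fourier_bound p C w"
  unfolding fourier_bound_def
proof (intro divide_right_mono sum_mono)
  fix \<xi>
  let ?f = "\<lambda>j. \<bar>cos (2 * pi * of_int \<xi> * of_int (w j) / p)\<bar>"
  have "prod ?f C' = prod ?f (C' - C) * prod ?f C"
    using assms by (intro prod.subset_diff)
  also have "\<dots> \<le> 1 * prod ?f C"
    by (intro mult_right_mono prod_le_1 prod_nonneg) auto
  finally show "prod ?f C' \<le> prod ?f C" by simp
qed auto

text \<open>Cosine is even. This absorbs the entries of a fixed sign matrix that multiply the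
  \<open>w j\<close> when signs are resampled.\<close>

lemma fourier_bound_cong:
  assumes "\<And>j. j \<in> C \<Longrightarrow> \<bar>w j\<bar> = \<bar>w' j\<bar>"
  shows "fourier_bound p C w = fourier_bound p C w'"
proof -
  have "\<bar>cos (2 * pi * of_int \<xi> * of_int (w j) / real p)\<bar> = \<bar>cos (2 * pi * of_int \<xi> * of_int (w' j) / p)\<bar>"
    if "j \<in> C" for \<xi> j
  proof -
    have "w j = w' j \<or> w j = - w' j" using assms[OF that] by linarith
    then show ?thesis by auto
  qed
  then show ?thesis unfolding fourier_bound_def by (simp cong: sum.cong prod.cong)
qed

lemma sum_if_const:
  assumes "finite A"
  shows "(\<Sum>x\<in>A. if P x then c else 0) = of_nat (card {x \<in> A. P x}) * (c :: 'a :: comm_semiring_1)"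
  using assms by (simp add: sum.inter_filter[symmetric])

text \<open>Orthogonality of the additive characters modulo \<open>p\<close>, as a geometric sum of
  a \<open>p\<close>-th root of unity.\<close>

lemma sum_cis_multiples:
  fixes p :: nat and a :: int
  assumes p: "p > 0"
  shows "(\<Sum>\<xi>\<in>{0..<int p}. cis (2 * pi * of_int \<xi> * of_int a / p)) = (if int p dvd a then of_nat p else 0)"
proof -
  define z where "z = cis (2 * pi * of_int a / p)"
  have pow: "cis (2 * pi * real k * of_int a / p) = z ^ k" for k
    unfolding z_def Complex.DeMoivre by (rule arg_cong[of _ _ cis]) simp
  have "(\<Sum>\<xi>\<in>{0..<int p}. cis (2 * pi * of_int \<xi> * of_int a / p)) = (\<Sum>k\<in>{0..<p}. z ^ k)"
  proof -
    have "{0..<int p} = int ` {0..<p}" by (simp add: image_int_atLeastLessThan)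
    then show ?thesis
      by (simp add: sum.reindex pow)
  qed
  moreover have "z = 1 \<longleftrightarrow> int p dvd a"
  proof
    assume "z = 1"
    then have "cos (2 * pi * of_int a / p) = 1" by (simp add: z_def complex_eq_iff)
    then obtain k :: int where "2 * pi * of_int a / p = of_int k * 2 * pi"
      using cos_one_2pi_int by auto
    then have "real_of_int a = of_int (k * int p)" using p by (simp add: field_simps)
    then have "a = k * int p" by (simp only: of_int_eq_iff)
    then show "int p dvd a" by simp
  next
    assume "int p dvd a"
    then obtain k where "a = int p * k" by (elim dvdE)
    then have "2 * pi * of_int a / p = 2 * pi * of_int k" using p by simp
    then show "z = 1" unfolding z_def by (simp add: complex_eq_iff)
  qed
  moreover have "(\<Sum>k\<in>{0..<p}. z ^ k) = 0" if "z \<noteq> 1"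
  proof -
    have "z ^ p = cis (2 * pi * of_int a)" using p by (simp add: z_def Complex.DeMoivre)
    then have "z ^ p = 1" by (simp add: complex_eq_iff)
    then show ?thesis using that by (simp add: geometric_sum atLeast0LessThan)
  qed
  ultimately show ?thesis by (cases "z = 1") auto
qed

text \<open>Fourier inversion: the congruence is detected by characters, and for each frequency the
  sum over the signs factors into terms \<open>2 * cos\<close>. The target \<open>c\<close> enters
  only through a phase, which the triangle inequality discards, so the bound is uniform in
  \<open>c\<close>.\<close>

lemma card_signed_sums_le:
  assumes p: "p > 0" and C: "finite C"
  shows "real (card {x \<in> C \<rightarrow>\<^sub>E {-1, 1}. int p dvd (\<Sum>j\<in>C. x j * w j) - c}) \<le> fourier_bound p C w * 2 ^ card C"
proof -
  let ?X = "C \<rightarrow>\<^sub>E {-1, 1::int}"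
  let ?e = "\<lambda>\<xi> a. cis (2 * pi * of_int \<xi> * of_int a / p)"
  have fin: "finite ?X" using C by (intro finite_PiE) auto
  have "of_nat p * of_nat (card {x \<in> ?X. int p dvd (\<Sum>j\<in>C. x j * w j) - c}) =
      (\<Sum>x\<in>?X. if int p dvd (\<Sum>j\<in>C. x j * w j) - c then of_nat p else (0::complex))"
    using fin by (simp add: sum.If_cases Collect_conj_eq Int_commute)
  also have "\<dots> = (\<Sum>x\<in>?X. \<Sum>\<xi>\<in>{0..<int p}. ?e \<xi> ((\<Sum>j\<in>C. x j * w j) - c))"
    using p by (simp only: sum_cis_multiples)
  also have "\<dots> = (\<Sum>\<xi>\<in>{0..<int p}. \<Sum>x\<in>?X. ?e \<xi> ((\<Sum>j\<in>C. x j * w j) - c))"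
    by (rule sum.swap)
  also have "\<dots> = (\<Sum>\<xi>\<in>{0..<int p}. ?e \<xi> (- c) * (\<Prod>j\<in>C. 2 * cos (2 * pi * of_int \<xi> * of_int (w j) / p)))"
  proof (rule sum.cong[OF refl])
    fix \<xi>
    have "?e \<xi> ((\<Sum>j\<in>C. x j * w j) - c) = ?e \<xi> (- c) * (\<Prod>j\<in>C. ?e \<xi> (x j * w j))" for x
    proof -
      have "(\<Prod>j\<in>C. ?e \<xi> (x j * w j)) = ?e \<xi> (\<Sum>j\<in>C. x j * w j)" using C
        by (induction C) (auto simp: cis_mult add_divide_distrib ring_distribs)
      then show ?thesis by (simp add: cis_mult diff_divide_distrib ring_distribs)
    qed
    then have "(\<Sum>x\<in>?X. ?e \<xi> ((\<Sum>j\<in>C. x j * w j) - c)) = ?e \<xi> (- c) * (\<Sum>x\<in>?X. \<Prod>j\<in>C. ?e \<xi> (x j * w j))"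
      by (simp add: sum_distrib_left)
    also have "(\<Sum>x\<in>?X. \<Prod>j\<in>C. ?e \<xi> (x j * w j)) = (\<Prod>j\<in>C. \<Sum>y\<in>{-1, 1}. ?e \<xi> (y * w j))"
      using C by (intro prod_sum_PiE[symmetric]) auto
    also have "\<dots> = (\<Prod>j\<in>C. complex_of_real (2 * cos (2 * pi * of_int \<xi> * of_int (w j) / p)))"
      by (intro prod.cong refl) (simp add: complex_eq_iff)
    also have "\<dots> = (\<Prod>j\<in>C. 2 * cos (2 * pi * of_int \<xi> * of_int (w j) / p))" by simp
    finally show "(\<Sum>x\<in>?X. ?e \<xi> ((\<Sum>j\<in>C. x j * w j) - c)) = ?e \<xi> (- c) * (\<Prod>j\<in>C. 2 * cos (2 * pi * of_int \<xi> * of_int (w j) / p))" by simp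
  qed
  finally have eq: "of_nat p * of_nat (card {x \<in> ?X. int p dvd (\<Sum>j\<in>C. x j * w j) - c}) =
      (\<Sum>\<xi>\<in>{0..<int p}. ?e \<xi> (- c) * (\<Prod>j\<in>C. 2 * cos (2 * pi * of_int \<xi> * of_int (w j) / p)))" .
  have "real p * real (card {x \<in> ?X. int p dvd (\<Sum>j\<in>C. x j * w j) - c}) =
     norm (of_nat p * of_nat (card {x \<in> ?X. int p dvd (\<Sum>j\<in>C. x j * w j) - c}) :: complex)"
    by (simp add: norm_mult)
  also have "\<dots> \<le> (\<Sum>\<xi>\<in>{0..<int p}. norm (?e \<xi> (- c) * (\<Prod>j\<in>C. 2 * cos (2 * pi * of_int \<xi> * of_int (w j) / p))))"
    unfolding eq by (rule norm_sum)
  also have "\<dots> = (\<Sum>\<xi>\<in>{0..<int p}. 2 ^ card C * (\<Prod>j\<in>C. \<bar>cos (2 * pi * of_int \<xi> * of_int (w j) / p)\<bar>))"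
    by (intro sum.cong refl) (simp add: norm_mult abs_prod abs_mult prod.distrib norm_power prod_norm[symmetric])
  also have "\<dots> = real p * (fourier_bound p C w * 2 ^ card C)"
    using p by (simp add: fourier_bound_def sum_distrib_left[symmetric])
  finally show ?thesis using p by simp
qed

section \<open>Growth of balls for a subadditive norm on the residues modulo a prime\<close>

text \<open>
  The walk \<open>0, \<eta>, 2\<eta>, \<dots>\<close> with \<open>\<eta>\<close> in the small ball reaches \<open>\<xi>\<close> in steps of length at most \<open>r\<close>,
  so the large ball contains about \<open>R / (3r)\<close> disjoint translates of the small one.
\<close>

lemma card_ball_le:
  fixes N :: "int \<Rightarrow> real" and p :: nat
  assumes p: "prime p" and N0: "N 0 = 0" and Nadd: "\<And>a b. N (a + b) \<le> N a + N b"
    and Nneg: "\<And>a. N (- a) = N a" and Nmod: "\<And>a. N (a mod int p) = N a"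
    and r: "r > 0" "4 * r \<le> R" and ex: "N \<xi> > R"
  shows "real (card {a \<in> {0..<int p}. N a \<le> r}) \<le> 1 + 6 * (r / R) * card {a \<in> {0..<int p}. N a \<le> R}"
proof -
  define A where "A r = {a \<in> {0..<int p}. N a \<le> r}" for r
  have fin: "finite (A r)" for r by (rule finite_subset[of _ "{0..<int p}"]) (auto simp: A_def)
  show ?thesis
  proof (cases "A r \<subseteq> {0}")
    case True
    then have "card (A r) \<le> 1" using card_mono[of "{0::int}" "A r"] by simp
    moreover have "6 * (r / R) * real (card (A R)) \<ge> 0" using r by simp
    ultimately show ?thesis unfolding A_def by linarith
  next
    case False
    then obtain \<eta> where \<eta>: "\<eta> \<in> {0..<int p}" "N \<eta> \<le> r" "\<eta> \<noteq> 0" by (auto simp: A_def)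
    have "\<not> int p dvd \<eta>" using \<eta> zdvd_imp_le[of "int p" \<eta>] by auto
    then have "coprime \<eta> (int p)" using p by (meson coprime_commute prime_imp_coprime prime_nat_int_transfer)
    then obtain u where u: "[\<eta> * u = 1] (mod int p)" using cong_solve_coprime_int by blast
    \<comment> \<open>Primality makes \<open>\<eta>\<close> invertible, so the walk arrives at
      \<open>\<xi>\<close> after \<open>J\<close> steps and therefore leaves the ball of radius
      \<open>R\<close>.\<close>
    define J where "J = nat ((u * \<xi>) mod int p)"
    have J: "int J = (u * \<xi>) mod int p" using p by (simp add: J_def prime_gt_0_nat)
    have "[int J * \<eta> = (\<eta> * u) * \<xi>] (mod int p)" unfolding J
      by (simp add: cong_def mod_mult_left_eq mod_mult_right_eq mult_ac)
    also have "[(\<eta> * u) * \<xi> = 1 * \<xi>] (mod int p)" by (intro cong_mult u cong_refl)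
    finally have "N (int J * \<eta>) = N \<xi>" using Nmod by (metis cong_def mult_1)
    then have NJ: "N (int J * \<eta>) > R" using ex by simp
    \<comment> \<open>The first time at which the walk is outside radius \<open>3 * k * r\<close>. A
      step changes \<open>N\<close> by at most \<open>r\<close>, so the walk has then not passed
      \<open>3 * k * r + r\<close>; this gap makes the translates of the small ball at these times
      disjoint. The number \<open>kk\<close> is chosen so that all these translates stay within
      radius \<open>R\<close>.\<close>
    define j where "j k = (LEAST j. N (int j * \<eta>) > 3 * real k * r)" for k
    define kk where "kk = nat \<lfloor>(R / r - 2) / 3\<rfloor> + 1"
    have kk: "(3 * real k + 2) * r \<le> R" if "k < kk" for k
    proof -
      have "0 \<le> (R / r - 2) / 3" using r by (simp add: field_simps)
      then have "int k \<le> \<lfloor>(R / r - 2) / 3\<rfloor>" using that unfolding kk_def by (simp add: le_nat_iff[symmetric])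
      then have "real k \<le> (R / r - 2) / 3" by (simp add: le_floor_iff)
      then show ?thesis using r by (simp add: field_simps)
    qed
    have jk: "3 * real k * r < N (int (j k) * \<eta>)" "N (int (j k) * \<eta>) \<le> 3 * real k * r + r" if "k < kk" for k
    proof -
      have "3 * real k * r \<le> R" using kk[OF that] r by (simp add: algebra_simps)
      then have "N (int J * \<eta>) > 3 * real k * r" using NJ by linarith
      then show 1: "3 * real k * r < N (int (j k) * \<eta>)" unfolding j_def by (rule LeastI)
      have "j k \<noteq> 0"
      proof
        assume "j k = 0"
        then show False using 1 N0 r by (simp add: mult_less_0_iff)
      qed
      then obtain i where i: "j k = Suc i" by (cases "j k") auto
      have "\<not> N (int i * \<eta>) > 3 * real k * r" using i unfolding j_def by (metis lessI not_less_Least)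
      moreover have "N (int (j k) * \<eta>) \<le> N (int i * \<eta>) + N \<eta>"
        using Nadd[of "int i * \<eta>" \<eta>] by (simp add: i algebra_simps)
      ultimately show "N (int (j k) * \<eta>) \<le> 3 * real k * r + r" using \<eta>(2) by linarith
    qed
    define F where "F = (\<lambda>(k, a). (int (j k) * \<eta> + a) mod int p)"
    have sep: False if "k < k'" "k' < kk" "a \<in> A r" "a' \<in> A r" "F (k, a) = F (k', a')" for k k' a a'
    proof -
      have "N (int (j k') * \<eta>) = N (int (j k) * \<eta> + a + - a')"
      proof -
        have "[int (j k) * \<eta> + a = int (j k') * \<eta> + a'] (mod int p)" using that(5) by (simp add: F_def cong_def)
        then have "[int (j k) * \<eta> + a - a' = int (j k') * \<eta> + a' - a'] (mod int p)" by (intro cong_diff cong_refl)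
        then have "[int (j k) * \<eta> + a + - a' = int (j k') * \<eta>] (mod int p)" by simp
        then show ?thesis using Nmod by (metis cong_def)
      qed
      also have "\<dots> \<le> N (int (j k) * \<eta>) + N a + N a'"
        using Nadd[of "int (j k) * \<eta> + a" "- a'"] Nadd[of "int (j k) * \<eta>" a] Nneg[of a'] by linarith
      also have "\<dots> \<le> 3 * real k * r + r + r + r"
        using jk(2)[of k] that by (auto simp: A_def)
      also have "\<dots> = 3 * (real k + 1) * r" by (simp add: algebra_simps)
      also have "\<dots> \<le> 3 * real k' * r" using that(1) r by (intro mult_right_mono) auto
      finally show False using jk(1)[of k'] that by linarith
    qed
    have "inj_on F ({..<kk} \<times> A r)"
    proof (rule inj_onI, clarify)
      fix k a k' a' assume *: "k < kk" "k' < kk" "a \<in> A r" "a' \<in> A r" "F (k, a) = F (k', a')"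
      then have "k = k'" using sep[of k k' a a'] sep[of k' k a' a] by (metis nat_neq_iff)
      moreover have "a = a'"
      proof -
        have "[int (j k) * \<eta> + a = int (j k) * \<eta> + a'] (mod int p)"
          using * \<open>k = k'\<close> by (simp add: F_def cong_def)
        then have "[a = a'] (mod int p)" by (simp add: cong_add_lcancel)
        then show ?thesis using * by (auto simp: A_def cong_def)
      qed
      ultimately show "k = k' \<and> a = a'" by simp
    qed
    moreover have "F ` ({..<kk} \<times> A r) \<subseteq> A R"
    proof clarify
      fix k a assume *: "k < kk" "a \<in> A r"
      have "N (F (k, a)) \<le> N (int (j k) * \<eta>) + N a" unfolding F_def by (simp add: Nmod Nadd)
      also have "\<dots> \<le> (3 * real k + 2) * r" using jk(2)[of k] * by (auto simp: A_def algebra_simps)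
      also have "\<dots> \<le> R" using kk * by auto
      finally show "F (k, a) \<in> A R" using p by (auto simp: A_def F_def prime_gt_0_nat)
    qed
    ultimately have "card ({..<kk} \<times> A r) \<le> card (A R)" using fin by (metis card_inj_on_le)
    then have c: "real kk * real (card (A r)) \<le> real (card (A R))"
      by (metis card_cartesian_product card_lessThan of_nat_le_iff of_nat_mult)
    \<comment> \<open>This is where \<open>4 * r \<le> R\<close> is used: it makes the loss of
      \<open>2\<close> against \<open>R / r\<close> at most a factor of two.\<close>
    have "R / r / 6 \<le> (R / r - 2) / 3" using r by (simp add: field_simps)
    also have "\<dots> \<le> real kk" unfolding kk_def by linarith
    finally have "R / r / 6 * real (card (A r)) \<le> real kk * real (card (A r))" by (intro mult_right_mono) auto
    with c have "R / r / 6 * real (card (A r)) \<le> real (card (A R))" by linarith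
    then have "real (card (A r)) \<le> 6 * (r / R) * card (A R)" using r by (simp add: field_simps)
    then show ?thesis unfolding A_def by linarith
  qed
qed

section \<open>Halasz-type estimates through the sine norm\<close>

lemma abs_cos_le_exp: "\<bar>cos x\<bar> \<le> exp (- ((sin x)\<^sup>2) / 2)" for x :: real
proof -
  have "(cos x)\<^sup>2 = 1 + (- (sin x)\<^sup>2)" by (simp add: cos_squared_eq)
  also have "\<dots> \<le> exp (- (sin x)\<^sup>2)" by (rule exp_ge_add_one_self)
  also have "\<dots> = (exp (- ((sin x)\<^sup>2) / 2))\<^sup>2" by (simp add: power2_eq_square flip: exp_add)
  finally show ?thesis by (metis abs_le_square_iff abs_of_nonneg exp_ge_zero)
qed

text \<open>The product of cosines in \<open>fourier_bound\<close> is at most \<open>exp\<close> of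
  minus half the square of this quantity. The l2 form is chosen because Minkowski's inequality and
  subadditivity of \<open>\<bar>sin\<bar>\<close> make it a norm to which
  \<open>card_ball_le\<close> applies.\<close>

definition sin_norm :: "nat \<Rightarrow> nat set \<Rightarrow> (nat \<Rightarrow> int) \<Rightarrow> int \<Rightarrow> real" where
  "sin_norm p C w \<xi> = L2_set (\<lambda>j. sin (2 * pi * of_int \<xi> * of_int (w j) / p)) C"

lemma sin_norm_power2: "(sin_norm p C w \<xi>)\<^sup>2 = (\<Sum>j\<in>C. (sin (2 * pi * of_int \<xi> * of_int (w j) / p))\<^sup>2)"
  by (simp add: sin_norm_def L2_set_def sum_nonneg)

lemma sin_norm_nonneg: "sin_norm p C w \<xi> \<ge> 0"
  by (simp add: sin_norm_def)

lemma abs_sin_add_le: "\<bar>sin (x + y)\<bar> \<le> \<bar>sin x\<bar> + \<bar>sin y\<bar>" for x y :: real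
proof -
  have "\<bar>sin (x + y)\<bar> \<le> \<bar>sin x * cos y\<bar> + \<bar>cos x * sin y\<bar>" unfolding sin_add by (rule abs_triangle_ineq)
  also have "\<dots> \<le> \<bar>sin x\<bar> * 1 + 1 * \<bar>sin y\<bar>" unfolding abs_mult by (intro add_mono mult_mono) auto
  finally show ?thesis by simp
qed

lemma sin_norm_add_le: "sin_norm p C w (a + b) \<le> sin_norm p C w a + sin_norm p C w b"
proof -
  let ?s = "\<lambda>a j. sin (2 * pi * of_int a * of_int (w j) / p)"
  have "L2_set (?s (a + b)) C = L2_set (\<lambda>j. \<bar>?s (a + b) j\<bar>) C" by (simp add: L2_set_def)
  also have "\<dots> \<le> L2_set (\<lambda>j. \<bar>?s a j\<bar> + \<bar>?s b j\<bar>) C"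
  proof (intro L2_set_mono)
    fix j
    show "\<bar>?s (a + b) j\<bar> \<le> \<bar>?s a j\<bar> + \<bar>?s b j\<bar>"
      using abs_sin_add_le[of "2 * pi * of_int a * of_int (w j) / p" "2 * pi * of_int b * of_int (w j) / p"]
      by (simp add: ring_distribs add_divide_distrib)
  qed auto
  also have "\<dots> \<le> L2_set (\<lambda>j. \<bar>?s a j\<bar>) C + L2_set (\<lambda>j. \<bar>?s b j\<bar>) C" by (rule L2_set_triangle_ineq)
  finally show ?thesis by (simp add: sin_norm_def L2_set_def)
qed

lemma sin_norm_uminus: "sin_norm p C w (- a) = sin_norm p C w a"
  by (simp add: sin_norm_def L2_set_def)

lemma sin_norm_mod:
  assumes "p > 0"
  shows "sin_norm p C w (a mod int p) = sin_norm p C w a"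
proof -
  have "sin (2 * pi * of_int a * of_int (w j) / p) = sin (2 * pi * of_int (a mod int p) * of_int (w j) / p)" for j
  proof -
    have "real_of_int a = real_of_int (a div int p) * real p + real_of_int (a mod int p)"
      by (metis div_mult_mod_eq of_int_add of_int_mult of_int_of_nat_eq)
    then have "2 * pi * of_int a * of_int (w j) / p =
        2 * pi * of_int (a mod int p) * of_int (w j) / p + 2 * pi * of_int (a div int p * w j)"
      using assms by (simp add: field_simps)
    then show ?thesis by (simp only: sin_add sin_int_2pin cos_int_2pin mult_zero_right mult_1_right add_0_right)
  qed
  then show ?thesis by (simp add: sin_norm_def)
qed

text \<open>Frequencies in the ball of radius \<open>r\<close> contribute at most 1 each and are
  counted by comparison with the ball of radius \<open>R\<close>; every other frequency contributes
  at most \<open>exp (- r\<^sup>2 / 2)\<close>.\<close>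

lemma fourier_bound_le_card_ball:
  assumes p: "prime p" and r: "r > 0" "4 * r \<le> R" and ex: "sin_norm p C w \<xi> > R"
  shows "fourier_bound p C w \<le> 1 / p
    + 6 * (r / R) * (card {a \<in> {0..<int p}. sin_norm p C w a \<le> R} / p) + exp (- (r\<^sup>2) / 2)"
proof -
  let ?N = "sin_norm p C w" and ?P = "{0..<int p}"
  have p0: "p > 0" using p by (simp add: prime_gt_0_nat)
  have "(\<Prod>j\<in>C. \<bar>cos (2 * pi * of_int a * of_int (w j) / p)\<bar>) \<le> (if ?N a \<le> r then 1 else 0) + exp (- (r\<^sup>2) / 2)" for a
  proof (cases "?N a \<le> r")
    case True
    have "(\<Prod>j\<in>C. \<bar>cos (2 * pi * of_int a * of_int (w j) / p)\<bar>) \<le> 1" by (intro prod_le_1) auto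
    then show ?thesis using True by (simp add: add_increasing2)
  next
    case False
    have "(\<Prod>j\<in>C. \<bar>cos (2 * pi * of_int a * of_int (w j) / p)\<bar>)
       \<le> (\<Prod>j\<in>C. exp (- ((sin (2 * pi * of_int a * of_int (w j) / p))\<^sup>2) / 2))"
      by (intro prod_mono conjI abs_cos_le_exp) auto
    also have "\<dots> = exp (- (?N a)\<^sup>2 / 2)"
    proof (cases "finite C")
      case True
      then show ?thesis
      by (simp add: sin_norm_power2 exp_sum[symmetric] sum_negf sum_divide_distrib)
    qed (simp add: sin_norm_def)
    also have "\<dots> \<le> exp (- (r\<^sup>2) / 2)" using False r by (simp add: power_mono)
    finally show ?thesis using False by simp
  qed
  then have "(\<Sum>a\<in>?P. \<Prod>j\<in>C. \<bar>cos (2 * pi * of_int a * of_int (w j) / p)\<bar>)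
      \<le> (\<Sum>a\<in>?P. (if ?N a \<le> r then 1 else 0) + exp (- (r\<^sup>2) / 2))" by (intro sum_mono)
  also have "\<dots> = card {a \<in> ?P. ?N a \<le> r} + p * exp (- (r\<^sup>2) / 2)"
    by (simp add: sum.distrib sum.If_cases Int_def)
  also have "\<dots> \<le> 1 + 6 * (r / R) * card {a \<in> ?P. ?N a \<le> R} + p * exp (- (r\<^sup>2) / 2)"
    using card_ball_le[of p ?N r R \<xi>, OF p _ sin_norm_add_le sin_norm_uminus sin_norm_mod[OF p0] r ex]
    by (simp add: sin_norm_def L2_set_def)
  finally show ?thesis using p0 unfolding fourier_bound_def by (simp add: field_simps)
qed

lemma sin_squared_eq_cos: "(sin x)\<^sup>2 = (1 - cos (2 * x)) / 2" for x :: real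
  by (simp add: cos_double_sin)

lemma odd_prime_dvd_double_iff:
  assumes "prime p" "odd p"
  shows "int p dvd 2 * v \<longleftrightarrow> int p dvd v"
proof -
  have "\<not> int p dvd 2"
  proof
    assume "int p dvd 2"
    then have "p dvd 2" by (metis int_dvd_int_iff of_nat_numeral)
    then show False using assms by (metis primes_dvd_imp_eq two_is_prime_nat dvd_refl)
  qed
  then show ?thesis using assms(1) by (simp add: prime_dvd_mult_iff)
qed

text \<open>By the double angle formula the claim is that the cosines at frequency
  \<open>2 * v\<close> sum to zero; since \<open>p\<close> is odd, \<open>2 * v\<close> is still
  nonzero modulo \<open>p\<close>.\<close>

lemma sum_sin_squared:
  assumes p: "prime p" "odd p" and v: "\<not> int p dvd v"
  shows "(\<Sum>a\<in>{0..<int p}. (sin (2 * pi * of_int a * of_int v / p))\<^sup>2) = p / 2"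
proof -
  have p0: "p > 0" using p by (simp add: prime_gt_0_nat)
  have "(\<Sum>a\<in>{0..<int p}. cos (2 * pi * of_int a * of_int (2 * v) / p)) =
      Re (\<Sum>a\<in>{0..<int p}. cis (2 * pi * of_int a * of_int (2 * v) / p))"
    by simp
  also have "\<dots> = 0" unfolding sum_cis_multiples[OF p0] using v by (simp add: odd_prime_dvd_double_iff p)
  finally have "(\<Sum>a\<in>{0..<int p}. cos (2 * (2 * pi * of_int a * of_int v / p))) = 0" by (simp add: mult_ac)
  then show ?thesis by (simp add: sin_squared_eq_cos sum_subtractf sum_divide_distrib[symmetric])
qed

text \<open>From \<open>(\<bar>cos x\<bar> - 1)\<^sup>2 \<ge> 0\<close> one gets
  \<open>\<bar>cos x\<bar> \<le> 1 - (sin x)\<^sup>2 / 2\<close>, and the mean of the squared sine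
  is 1/2.\<close>

lemma fourier_bound_single_le:
  assumes p: "prime p" "odd p" and w: "\<not> int p dvd w j"
  shows "fourier_bound p {j} w \<le> 3 / 4"
proof -
  let ?x = "\<lambda>a. 2 * pi * of_int a * of_int (w j) / p"
  have p0: "p > 0" using p by (simp add: prime_gt_0_nat)
  have "\<bar>cos x\<bar> \<le> 1 - (sin x)\<^sup>2 / 2" for x :: real
    using zero_le_power2[of "\<bar>cos x\<bar> - 1"] by (simp add: power2_diff cos_squared_eq)
  then have "(\<Sum>a\<in>{0..<int p}. \<bar>cos (?x a)\<bar>) \<le> (\<Sum>a\<in>{0..<int p}. 1 - (sin (?x a))\<^sup>2 / 2)"
    by (intro sum_mono)
  also have "\<dots> = 3 / 4 * p"
    using sum_sin_squared[OF p w] by (simp add: sum_subtractf sum_divide_distrib[symmetric])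
  finally show ?thesis using p0 by (simp add: fourier_bound_def field_simps)
qed

text \<open>A Littlewood-Offord bound. The mean of the squared sine norm is
  \<open>card C / 2\<close>, so some frequency lies beyond radius \<open>sqrt (card C) / 2\<close>;
  the density of the ball of that radius is estimated trivially by 1.\<close>

lemma fourier_bound_nonzero_le:
  fixes r :: real
  assumes p: "prime p" "odd p" and C: "finite C" and s: "card C > 0"
    and w: "\<And>j. j \<in> C \<Longrightarrow> \<not> int p dvd w j"
    and r: "r > 0" "8 * r \<le> sqrt (card C)"
  shows "fourier_bound p C w \<le> 1 / p + 12 * r / sqrt (card C) + exp (- (r\<^sup>2) / 2)"
proof -
  let ?N = "sin_norm p C w" and ?P = "{0..<int p}" and ?R = "sqrt (card C) / 2"
  have p0: "p > 0" using p by (simp add: prime_gt_0_nat)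
  have "(\<Sum>a\<in>?P. (?N a)\<^sup>2) = (\<Sum>j\<in>C. \<Sum>a\<in>?P. (sin (2 * pi * of_int a * of_int (w j) / p))\<^sup>2)"
    unfolding sin_norm_power2 by (rule sum.swap)
  also have "\<dots> = (\<Sum>j\<in>C. p / 2)" by (intro sum.cong sum_sin_squared p w refl)
  also have "\<dots> = card C * (p / 2)" by simp
  finally have tot: "(\<Sum>a\<in>?P. (?N a)\<^sup>2) = card C * (p / 2)" .
  have "\<exists>\<xi>. ?N \<xi> > ?R"
  proof (rule ccontr)
    assume "\<not> ?thesis"
    then have "(?N a)\<^sup>2 \<le> ?R\<^sup>2" for a by (intro power_mono sin_norm_nonneg) (auto simp: not_less)
    then have "(\<Sum>a\<in>?P. (?N a)\<^sup>2) \<le> (\<Sum>a\<in>?P. ?R\<^sup>2)" by (intro sum_mono)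
    then show False using tot s p0 by (simp add: power_divide)
  qed
  then obtain \<xi> where \<xi>: "?N \<xi> > ?R" by auto
  have "card {a \<in> ?P. ?N a \<le> ?R} \<le> card ?P" by (intro card_mono) auto
  then have "card {a \<in> ?P. ?N a \<le> ?R} / p \<le> 1" using p0 by simp
  then have "6 * (r / ?R) * (card {a \<in> ?P. ?N a \<le> ?R} / p) \<le> 6 * (r / ?R) * 1"
    using r by (intro mult_left_mono) auto
  moreover have "fourier_bound p C w \<le> 1 / p + 6 * (r / ?R) * (card {a \<in> ?P. ?N a \<le> ?R} / p) + exp (- (r\<^sup>2) / 2)"
    using r by (intro fourier_bound_le_card_ball[OF p(1) _ _ \<xi>]) auto
  ultimately show ?thesis by simp
qed

text \<open>The previous bound gains a factor \<open>4 * t / card C\<close> from a better density of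
  the large ball. The second moment of the exponential sum over \<open>C\<close> counts coinciding
  pairs, while in that ball the sum has real part at least \<open>card C / 2\<close>, so Markov's
  inequality bounds the number of such frequencies.\<close>

lemma fourier_bound_few_coincidences_le:
  fixes r t :: real
  assumes p: "prime p" "odd p" and C: "finite C" and s: "card C > 0"
    and t: "card {x \<in> C \<times> C. int p dvd w (fst x) - w (snd x)} \<le> card C * t" "4 * t < card C"
    and r: "r > 0" "8 * r \<le> sqrt (card C)"
  shows "fourier_bound p C w \<le> 1 / p + 48 * r * t / (card C * sqrt (card C)) + exp (- (r\<^sup>2) / 2)"
proof -
  let ?N = "sin_norm p C w" and ?P = "{0..<int p}" and ?R = "sqrt (card C) / 2"
  \<comment> \<open>The angle is doubled so that the squared sine at \<open>w j\<close> is
    \<open>(1 - cos) / 2\<close> with this cosine the real part of \<open>?e\<close>.\<close>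
  let ?e = "\<lambda>a v. cis (2 * pi * of_int a * of_int (2 * v) / p)"
  let ?A = "{a \<in> ?P. ?N a \<le> ?R}"
  have p0: "p > 0" using p by (simp add: prime_gt_0_nat)
  have "complex_of_real (\<Sum>a\<in>?P. (norm (\<Sum>j\<in>C. ?e a (w j)))\<^sup>2) =
      (\<Sum>a\<in>?P. \<Sum>x\<in>C \<times> C. ?e a (w (fst x) - w (snd x)))"
  proof -
    have "complex_of_real ((norm (\<Sum>j\<in>C. ?e a (w j)))\<^sup>2) = (\<Sum>x\<in>C \<times> C. ?e a (w (fst x) - w (snd x)))" for a
    proof -
      have m: "cis u * cnj (cis v) = cis (u - v)" for u v by (simp add: cis_cnj cis_mult)
      have "complex_of_real ((norm (\<Sum>j\<in>C. ?e a (w j)))\<^sup>2) = (\<Sum>j\<in>C. ?e a (w j)) * cnj (\<Sum>j\<in>C. ?e a (w j))"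
        by (rule complex_norm_square)
      also have "\<dots> = (\<Sum>x\<in>C \<times> C. ?e a (w (fst x)) * cnj (?e a (w (snd x))))"
        unfolding cnj_sum sum_product sum.cartesian_product case_prod_unfold ..
      also have "\<dots> = (\<Sum>x\<in>C \<times> C. ?e a (w (fst x) - w (snd x)))"
        unfolding m by (intro sum.cong refl arg_cong[of _ _ cis]) (simp add: ring_distribs diff_divide_distrib)
      finally show ?thesis .
    qed
    then show ?thesis by (simp only: of_real_sum)
  qed
  also have "\<dots> = (\<Sum>x\<in>C \<times> C. \<Sum>a\<in>?P. ?e a (w (fst x) - w (snd x)))"
    by (rule sum.swap)
  also have "\<dots> = (\<Sum>x\<in>C \<times> C. if int p dvd w (fst x) - w (snd x) then of_nat p else 0)"
    unfolding sum_cis_multiples[OF p0] odd_prime_dvd_double_iff[OF p] ..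
  also have "\<dots> = of_nat (card {x \<in> C \<times> C. int p dvd w (fst x) - w (snd x)} * p)"
    unfolding of_nat_mult using C by (intro sum_if_const) auto
  also have "\<dots> = complex_of_real (card {x \<in> C \<times> C. int p dvd w (fst x) - w (snd x)} * p)"
    by (rule of_real_of_nat_eq[symmetric])
  finally have "(\<Sum>a\<in>?P. (norm (\<Sum>j\<in>C. ?e a (w j)))\<^sup>2) = card {x \<in> C \<times> C. int p dvd w (fst x) - w (snd x)} * p"
    by (simp only: of_real_eq_iff)
  also have "\<dots> \<le> card C * t * p" using t(1) by (simp add: mult_right_mono)
  finally have up: "(\<Sum>a\<in>?P. (norm (\<Sum>j\<in>C. ?e a (w j)))\<^sup>2) \<le> card C * t * p" .
  have low: "(norm (\<Sum>j\<in>C. ?e a (w j)))\<^sup>2 \<ge> (card C / 2)\<^sup>2" if "a \<in> ?A" for a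
  proof -
    have "(?N a)\<^sup>2 \<le> ?R\<^sup>2" using that by (intro power_mono sin_norm_nonneg) auto
    then have "(?N a)\<^sup>2 \<le> card C / 4" by (simp add: power_divide)
    moreover have "(?N a)\<^sup>2 = (card C - (\<Sum>j\<in>C. cos (2 * pi * of_int a * of_int (2 * w j) / p))) / 2"
      unfolding sin_norm_power2 sin_squared_eq_cos by (simp add: sum_subtractf sum_divide_distrib[symmetric] mult_ac)
    ultimately have "card C / 2 \<le> Re (\<Sum>j\<in>C. ?e a (w j))" by simp
    also have "\<dots> \<le> norm (\<Sum>j\<in>C. ?e a (w j))" by (rule complex_Re_le_cmod)
    finally show ?thesis by (intro power_mono) auto
  qed
  have "card ?A * (card C / 2)\<^sup>2 = (\<Sum>a\<in>?A. (card C / 2)\<^sup>2)" by simp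
  also have "\<dots> \<le> (\<Sum>a\<in>?A. (norm (\<Sum>j\<in>C. ?e a (w j)))\<^sup>2)" using low by (intro sum_mono) auto
  also have "\<dots> \<le> (\<Sum>a\<in>?P. (norm (\<Sum>j\<in>C. ?e a (w j)))\<^sup>2)" by (intro sum_mono2) auto
  also note up
  finally have "card C * (card ?A * card C / 4) \<le> card C * (t * p)" by (simp add: power2_eq_square field_simps)
  then have "card ?A * card C / 4 \<le> t * p" using s by (subst (asm) mult_le_cancel_left_pos) auto
  then have A: "card ?A / p \<le> 4 * t / card C" using s p0 by (simp add: field_simps)
  \<comment> \<open>Hence the large ball is not everything, which provides the frequency beyond
    radius \<open>?R\<close> that the ball comparison requires.\<close>
  have "4 * t / card C < 1" using t(2) s by simp
  with A have "card ?A / p < 1" by linarith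
  then have cA: "card ?A < p" using p0 by (simp only: divide_less_eq_1_pos of_nat_0_less_iff of_nat_less_iff)
  have "?A \<noteq> ?P"
  proof
    assume "?A = ?P"
    then have "card ?A = card ?P" by (rule arg_cong)
    then show False using cA by simp
  qed
  then have "\<exists>\<xi>\<in>?P. \<not> ?N \<xi> \<le> ?R" by blast
  then obtain \<xi> where \<xi>: "?N \<xi> > ?R" by (auto simp only: not_le)
  have "6 * (r / ?R) * (card ?A / p) \<le> 6 * (r / ?R) * (4 * t / card C)"
    using r by (intro mult_left_mono A) auto
  moreover have "fourier_bound p C w \<le> 1 / p + 6 * (r / ?R) * (card ?A / p) + exp (- (r\<^sup>2) / 2)"
    using r by (intro fourier_bound_le_card_ball[OF p(1) _ _ \<xi>]) auto
  ultimately show ?thesis by (simp add: mult_ac)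
qed

section \<open>Random symmetric sign matrices\<close>

lemma card_Collect_bij_betw:
  assumes "bij_betw f A B"
  shows "card {b \<in> B. P b} = card {a \<in> A. P (f a)}"
proof -
  have "{b \<in> B. P b} = f ` {a \<in> A. P (f a)}"
    using assms by (auto simp: bij_betw_def)
  moreover have "inj_on f {a \<in> A. P (f a)}"
    using assms by (auto simp: bij_betw_def intro: inj_on_subset)
  ultimately show ?thesis by (simp add: card_image)
qed

text \<open>Resampling by double counting of pairs \<open>(x, \<omega>)\<close>: each
  \<open>act x\<close> preserves the uniform distribution on \<open>\<Omega>\<close>, so a bound
  over the random \<open>x\<close> with \<open>\<omega>\<close> fixed passes to
  \<open>\<omega>\<close>. This takes the place of conditioning and independence.\<close>

lemma card_le_average:
  fixes \<rho> :: real
  assumes fin: "finite \<Omega>" "finite X" "X \<noteq> {}"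
    and bij: "\<And>x. x \<in> X \<Longrightarrow> bij_betw (act x) \<Omega> \<Omega>"
    and le: "\<And>\<omega>. \<omega> \<in> \<Omega> \<Longrightarrow> real (card {x \<in> X. P (act x \<omega>)}) \<le> \<rho> * card X"
  shows "real (card {\<omega> \<in> \<Omega>. P \<omega>}) \<le> \<rho> * card \<Omega>"
proof -
  have "(\<Sum>x\<in>X. card {\<omega> \<in> \<Omega>. P \<omega>}) = (\<Sum>x\<in>X. card {\<omega> \<in> \<Omega>. P (act x \<omega>)})"
  proof (intro sum.cong refl)
    fix x assume x: "x \<in> X"
    show "card {\<omega> \<in> \<Omega>. P \<omega>} = card {\<omega> \<in> \<Omega>. P (act x \<omega>)}"
      by (rule card_Collect_bij_betw[OF bij[OF x]])
  qed
  also have "\<dots> = (\<Sum>x\<in>X. \<Sum>\<omega>\<in>\<Omega>. if P (act x \<omega>) then 1 else 0)"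
    using fin by (simp add: sum_if_const)
  also have "\<dots> = (\<Sum>\<omega>\<in>\<Omega>. \<Sum>x\<in>X. if P (act x \<omega>) then 1 else 0)" by (rule sum.swap)
  also have "\<dots> = (\<Sum>\<omega>\<in>\<Omega>. card {x \<in> X. P (act x \<omega>)})" using fin by (simp add: sum_if_const)
  finally have "real (card X) * card {\<omega> \<in> \<Omega>. P \<omega>} = (\<Sum>\<omega>\<in>\<Omega>. real (card {x \<in> X. P (act x \<omega>)}))"
    by (simp flip: of_nat_mult of_nat_sum)
  also have "\<dots> \<le> (\<Sum>\<omega>\<in>\<Omega>. \<rho> * card X)" by (intro sum_mono le)
  finally have "real (card X) * card {\<omega> \<in> \<Omega>. P \<omega>} \<le> real (card X) * (\<rho> * card \<Omega>)" by (simp add: mult_ac)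
  moreover have "real (card X) > 0" using fin by (simp add: card_gt_0_iff)
  ultimately show ?thesis by simp
qed

text \<open>Integer functions rather than matrices, so that rows and columns can be restricted to
  any index set and reduced modulo \<open>p\<close>. The value 0 outside the square makes the
  correspondence with matrices bijective.\<close>

definition sym_signs :: "nat \<Rightarrow> (nat \<Rightarrow> nat \<Rightarrow> int) set" where
  "sym_signs n = {M. (\<forall>i j. M i j = M j i) \<and> (\<forall>i<n. \<forall>j<n. M i j \<in> {-1, 1}) \<and> (\<forall>i j. n \<le> i \<or> n \<le> j \<longrightarrow> M i j = 0)}"

lemma bij_betw_sym_signs_mats:
  "bij_betw (\<lambda>M. Matrix.mat n n (\<lambda>(i, j). real_of_int (M i j))) (sym_signs n) (sym_sign_mats n)"
proof (rule bij_betw_byWitness[where f' = "\<lambda>A i j. if i < n \<and> j < n then \<lfloor>A $$ (i, j)\<rfloor> else 0"])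
  show "\<forall>M\<in>sym_signs n. (\<lambda>i j. if i < n \<and> j < n then
      \<lfloor>Matrix.mat n n (\<lambda>(i, j). real_of_int (M i j)) $$ (i, j)\<rfloor> else 0) = M"
    by (auto simp: sym_signs_def fun_eq_iff)
  show "\<forall>A\<in>sym_sign_mats n. Matrix.mat n n (\<lambda>(i, j). real_of_int (if i < n \<and> j < n then \<lfloor>A $$ (i, j)\<rfloor> else 0)) = A"
  proof
    fix A assume A: "A \<in> sym_sign_mats n"
    have "real_of_int \<lfloor>A $$ (i, j)\<rfloor> = A $$ (i, j)" if "i < n" "j < n" for i j
    proof -
      have "A $$ (i, j) = -1 \<or> A $$ (i, j) = 1" using A that by (auto simp: sym_sign_mats_def)
      then show ?thesis by (elim disjE) (simp_all add: floor_eq_iff)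
    qed
    then show "Matrix.mat n n (\<lambda>(i, j). real_of_int (if i < n \<and> j < n then \<lfloor>A $$ (i, j)\<rfloor> else 0)) = A"
      using A by (intro eq_matI) (auto simp: sym_sign_mats_def)
  qed
  show "(\<lambda>M. Matrix.mat n n (\<lambda>(i, j). real_of_int (M i j))) ` sym_signs n \<subseteq> sym_sign_mats n"
    by (auto simp: sym_signs_def sym_sign_mats_def intro!: eq_matI) (metis of_int_1 of_int_minus)
  show "(\<lambda>A i j. if i < n \<and> j < n then \<lfloor>A $$ (i, j)\<rfloor> else 0) ` sym_sign_mats n \<subseteq> sym_signs n"
  proof clarify
    fix A assume A: "A \<in> sym_sign_mats n"
    have "A $$ (i, j) = A $$ (j, i)" if "i < n" "j < n" for i j
    proof -
      have "A $$ (i, j) = transpose_mat A $$ (i, j)" using A by (simp add: sym_sign_mats_def)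
      also have "\<dots> = A $$ (j, i)"
        using A that by (intro index_transpose_mat) (auto simp: sym_sign_mats_def)
      finally show ?thesis .
    qed
    moreover have "\<lfloor>A $$ (i, j)\<rfloor> \<in> {-1, 1}" if "i < n" "j < n" for i j
    proof -
      have "A $$ (i, j) = -1 \<or> A $$ (i, j) = 1" using A that by (auto simp: sym_sign_mats_def)
      then show ?thesis by (elim disjE) (simp_all add: floor_eq_iff)
    qed
    ultimately show "(\<lambda>i j. if i < n \<and> j < n then \<lfloor>A $$ (i, j)\<rfloor> else 0) \<in> sym_signs n"
      unfolding sym_signs_def by simp
  qed
qed

lemma finite_sym_signs: "finite (sym_signs n)"
  using bij_betw_finite[OF bij_betw_sym_signs_mats] finite_sym_sign_mats by blast

text \<open>Multiplication by a fixed symmetric sign pattern is an involution. These are the actions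
  used with \<open>card_le_average\<close>.\<close>

lemma bij_betw_sign_flip:
  assumes sym: "\<And>i j. S i j = S j i" and sgn: "\<And>i j. S i j \<in> {-1, 1::int}"
  shows "bij_betw (\<lambda>M i j. S i j * M i j) (sym_signs n) (sym_signs n)"
proof -
  have sq: "S i j * (S i j * x) = x" for i j x using sgn[of i j] by auto
  have "S i j * y \<in> {-1, 1}" if "y \<in> {-1, 1}" for i j y using sgn[of i j] that by auto
  then have "(\<lambda>i j. S i j * M i j) \<in> sym_signs n" if "M \<in> sym_signs n" for M
    using that sym unfolding sym_signs_def by auto
  then show ?thesis
    by (intro bij_betw_byWitness[where f' = "\<lambda>M i j. S i j * M i j"]) (auto simp: sq)
qed

text \<open>
  Only the entries in \<open>R \<times> C\<close> are used; they are independent because \<open>R\<close> and \<open>C\<close> are disjoint.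
\<close>

lemma card_rows_vanish_le:
  assumes p: "p > 0" and D: "D \<subseteq> {..<n}" and C: "C \<subseteq> D" and R: "R \<subseteq> D" and disj: "R \<inter> C = {}"
  shows "real (card {M \<in> sym_signs n. \<forall>r\<in>R. int p dvd (\<Sum>j\<in>D. M r j * w j)})
    \<le> fourier_bound p C w ^ card R * card (sym_signs n)"
proof -
  let ?X = "R \<rightarrow>\<^sub>E (C \<rightarrow>\<^sub>E {-1, 1::int})"
  \<comment> \<open>The entries in \<open>R \<times> C\<close> and their mirror images receive fresh
    signs and all others are kept; disjointness of \<open>R\<close> and \<open>C\<close> keeps the
    two blocks from clashing.\<close>
  define S where "S X i j = (if i \<in> R \<and> j \<in> C then X i j else if j \<in> R \<and> i \<in> C then X j i else 1)"
    for X :: "nat \<Rightarrow> nat \<Rightarrow> int" and i j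
  have finD: "finite D" using D finite_subset by blast
  have finC: "finite C" and finR: "finite R" using finD C R finite_subset by blast+
  have S: "S X i j = S X j i" "S X i j \<in> {-1, 1}" if "X \<in> ?X" for X i j
    using that disj by (auto simp: S_def PiE_def Pi_def)
  show ?thesis
  proof (rule card_le_average[where X = ?X and act = "\<lambda>X M i j. S X i j * M i j"])
    show "finite (sym_signs n)" by (rule finite_sym_signs)
    show "finite ?X" using finC finR by (intro finite_PiE) auto
    show "?X \<noteq> {}" by (auto simp: PiE_eq_empty_iff)
    show "bij_betw (\<lambda>M i j. S X i j * M i j) (sym_signs n) (sym_signs n)" if "X \<in> ?X" for X
      using S[OF that] by (intro bij_betw_sign_flip) auto
    fix M assume M: "M \<in> sym_signs n"
    define c where "c r = - (\<Sum>j\<in>D - C. M r j * w j)" for r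
    let ?Q = "\<lambda>r. {x \<in> C \<rightarrow>\<^sub>E {-1, 1}. int p dvd (\<Sum>j\<in>C. x j * (M r j * w j)) - c r}"
    have row: "(\<Sum>j\<in>D. S X r j * M r j * w j) = (\<Sum>j\<in>C. X r j * (M r j * w j)) - c r" if "r \<in> R" for X r
    proof -
      have "(\<Sum>j\<in>D. S X r j * M r j * w j) = (\<Sum>j\<in>D - C. S X r j * M r j * w j) + (\<Sum>j\<in>C. S X r j * M r j * w j)"
        using C finD by (intro sum.subset_diff)
      also have "(\<Sum>j\<in>D - C. S X r j * M r j * w j) = - c r"
        unfolding c_def using that disj by (auto simp: S_def intro!: sum.cong)
      also have "(\<Sum>j\<in>C. S X r j * M r j * w j) = (\<Sum>j\<in>C. X r j * (M r j * w j))"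
        using that by (intro sum.cong) (auto simp: S_def)
      finally show ?thesis by simp
    qed
    \<comment> \<open>Each row in \<open>R\<close> has its own signs \<open>X r\<close>, so the
      admissible \<open>X\<close> form a product over the rows and the probabilities
      multiply.\<close>
    have "{X \<in> ?X. \<forall>r\<in>R. int p dvd (\<Sum>j\<in>D. S X r j * M r j * w j)} = Pi\<^sub>E R ?Q"
      using row by (auto simp: PiE_def Pi_def extensional_def)
    then have "real (card {X \<in> ?X. \<forall>r\<in>R. int p dvd (\<Sum>j\<in>D. S X r j * M r j * w j)}) = (\<Prod>r\<in>R. real (card (?Q r)))"
      using finR by (simp add: card_PiE)
    also have "\<dots> \<le> (\<Prod>r\<in>R. fourier_bound p C w * 2 ^ card C)"
    proof (intro prod_mono conjI)
      fix r assume r: "r \<in> R"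
      have "fourier_bound p C (\<lambda>j. M r j * w j) = fourier_bound p C w"
      proof (rule fourier_bound_cong)
        fix j assume "j \<in> C"
        then have "M r j \<in> {-1, 1}" using M r C R D unfolding sym_signs_def by blast
        then show "\<bar>M r j * w j\<bar> = \<bar>w j\<bar>" by auto
      qed
      then show "real (card (?Q r)) \<le> fourier_bound p C w * 2 ^ card C"
        using card_signed_sums_le[OF p finC, of "\<lambda>j. M r j * w j" "c r"] by simp
    qed auto
    also have "\<dots> = fourier_bound p C w ^ card R * card ?X"
      using finR finC by (simp add: card_PiE power_mult_distrib)
    finally show "real (card {X \<in> ?X. \<forall>r\<in>R. int p dvd (\<Sum>j\<in>D. S X r j * M r j * w j)})
      \<le> fourier_bound p C w ^ card R * real (card ?X)" .
  qed
qed


section \<open>Union bound over structured vectors\<close>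

text \<open>Choose the exceptional set \<open>P\<close>, then the value set \<open>V\<close>, then
  values from \<open>V\<close> on \<open>E - P\<close> and arbitrary residues on the rest of
  \<open>D\<close>.\<close>

lemma card_mostly_few_values_le:
  assumes D: "finite D" and E: "E \<subseteq> D" and s: "s \<le> card E"
  shows "card {w \<in> D \<rightarrow>\<^sub>E {0..<int p}. \<exists>P V. P \<subseteq> E \<and> card P = s \<and> V \<subseteq> {0..<int p} \<and> card V = q \<and> (\<forall>j\<in>E - P. w j \<in> V)}
    \<le> card E ^ s * p ^ q * (q ^ (card E - s) * p ^ (card (D - E) + s))"
proof -
  let ?Ps = "{P. P \<subseteq> E \<and> card P = s}" and ?Vs = "{V. V \<subseteq> {0..<int p} \<and> card V = q}"
  let ?W = "\<lambda>P V. Pi\<^sub>E D (\<lambda>j. if j \<in> E - P then V else {0..<int p})"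
  have finE: "finite E" using D E finite_subset by blast
  have fP: "finite ?Ps" and fV: "finite ?Vs" using finE by auto
  have cW: "card (?W P V) = q ^ (card E - s) * p ^ (card (D - E) + s)" if "P \<in> ?Ps" "V \<in> ?Vs" for P V
  proof -
    have finP: "finite P" using that finE finite_subset by blast
    have "card (?W P V) = (\<Prod>j\<in>D. if j \<in> E - P then q else p)"
      using D that by (subst card_PiE) (auto intro!: prod.cong)
    also have "\<dots> = q ^ card (E - P) * p ^ card (D - (E - P))"
    proof -
      have "D \<inter> {j. j \<in> E - P} = E - P" "D \<inter> - {j. j \<in> E - P} = D - (E - P)" using E by auto
      then show ?thesis using D by (simp add: prod.If_cases)
    qed
    also have "card (E - P) = card E - s" using that finP by (simp add: card_Diff_subset)
    also have "card (D - (E - P)) = card (D - E) + s"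
    proof -
      have "D - (E - P) = (D - E) \<union> P" using that E by auto
      moreover have "card ((D - E) \<union> P) = card (D - E) + card P"
        using that D finP by (intro card_Un_disjoint) auto
      ultimately show ?thesis using that by simp
    qed
    finally show ?thesis .
  qed
  have "card {w \<in> D \<rightarrow>\<^sub>E {0..<int p}. \<exists>P V. P \<subseteq> E \<and> card P = s \<and> V \<subseteq> {0..<int p} \<and> card V = q \<and> (\<forall>j\<in>E - P. w j \<in> V)}
    \<le> card (\<Union>(P, V)\<in>?Ps \<times> ?Vs. ?W P V)"
  proof (rule card_mono)
    show "finite (\<Union>(P, V)\<in>?Ps \<times> ?Vs. ?W P V)"
      using fP fV D by (intro finite_UN_I finite_cartesian_product) (auto intro!: finite_PiE dest: finite_subset)
    show "{w \<in> D \<rightarrow>\<^sub>E {0..<int p}. \<exists>P V. P \<subseteq> E \<and> card P = s \<and> V \<subseteq> {0..<int p} \<and> card V = q \<and> (\<forall>j\<in>E - P. w j \<in> V)}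
      \<subseteq> (\<Union>(P, V)\<in>?Ps \<times> ?Vs. ?W P V)"
    proof
      fix w assume "w \<in> {w \<in> D \<rightarrow>\<^sub>E {0..<int p}. \<exists>P V. P \<subseteq> E \<and> card P = s \<and> V \<subseteq> {0..<int p} \<and> card V = q \<and> (\<forall>j\<in>E - P. w j \<in> V)}"
      then obtain P V where *: "w \<in> D \<rightarrow>\<^sub>E {0..<int p}" "P \<in> ?Ps" "V \<in> ?Vs" "\<forall>j\<in>E - P. w j \<in> V" by blast
      then have "w \<in> ?W P V" by (auto simp: PiE_def Pi_def)
      then show "w \<in> (\<Union>(P, V)\<in>?Ps \<times> ?Vs. ?W P V)" using *(2,3) by blast
    qed
  qed
  also have "\<dots> \<le> (\<Sum>PV\<in>?Ps \<times> ?Vs. card (case PV of (P, V) \<Rightarrow> ?W P V))"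
    using fP fV by (intro card_UN_le finite_cartesian_product)
  also have "\<dots> = (\<Sum>PV\<in>?Ps \<times> ?Vs. q ^ (card E - s) * p ^ (card (D - E) + s))"
  proof (intro sum.cong refl)
    fix PV assume "PV \<in> ?Ps \<times> ?Vs"
    then obtain P V where "PV = (P, V)" "P \<in> ?Ps" "V \<in> ?Vs" by blast
    then show "card (case PV of (P, V) \<Rightarrow> ?W P V) = q ^ (card E - s) * p ^ (card (D - E) + s)"
      using cW by (simp only: prod.case)
  qed
  also have "\<dots> = card ?Ps * card ?Vs * (q ^ (card E - s) * p ^ (card (D - E) + s))"
    by (simp add: card_cartesian_product)
  also have "\<dots> \<le> card E ^ s * p ^ q * (q ^ (card E - s) * p ^ (card (D - E) + s))"
  proof (rule mult_right_mono[OF mult_mono])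
    show "card ?Ps \<le> card E ^ s" using finE s by (simp add: n_subsets binomial_le_pow)
    show "card ?Vs \<le> p ^ q"
    proof (cases "q \<le> p")
      case True
      then show ?thesis by (simp add: n_subsets binomial_le_pow)
    next
      case False
      then show ?thesis by (simp add: n_subsets binomial_eq_0)
    qed
  qed auto
  finally show ?thesis .
qed

text \<open>The witness \<open>w\<close> is a structured vector annihilated by the rows in
  \<open>E\<close>: sparse on \<open>E\<close> or too concentrated there. With
  \<open>D = E = {..<n}\<close> this concerns kernel vectors of the whole matrix; with
  \<open>D = {..<n} - {i}\<close> and a smaller \<open>E\<close> it concerns the coefficient vectors
  that arise from decoupling.\<close>

definition bad_mats :: "nat \<Rightarrow> nat \<Rightarrow> nat set \<Rightarrow> nat set \<Rightarrow> nat \<Rightarrow> real \<Rightarrow> (nat \<Rightarrow> nat \<Rightarrow> int) set" where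
  "bad_mats n p D E s \<epsilon> = {M \<in> sym_signs n. \<exists>w \<in> D \<rightarrow>\<^sub>E {0..<int p}. (\<exists>j\<in>D. w j \<noteq> 0) \<and>
     (\<forall>r\<in>E. int p dvd (\<Sum>j\<in>D. M r j * w j)) \<and> (card {j \<in> E. w j \<noteq> 0} < s \<or> fourier_bound p E w > \<epsilon>)}"

text \<open>A union bound over the witnesses. Sparse ones are few, and one nonzero coordinate gives
  a factor 3/4 per row. The others have at least \<open>s\<close> nonzero coordinates on
  \<open>E\<close>, giving a factor \<open>\<rho>\<close> per row outside the \<open>s\<close>
  chosen columns, and excessive concentration forces them to take at most \<open>q\<close> values
  off \<open>s\<close> coordinates.\<close>

lemma card_bad_mats_le:
  assumes p: "prime p" "odd p" and D: "D \<subseteq> {..<n}" and E: "E \<subseteq> D" and s: "s \<le> card E"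
    and q: "q \<le> p" "card E < Suc q * t" and \<rho>: "\<rho> \<ge> 0"
    and nonzero: "\<And>C w. finite C \<Longrightarrow> card C = s \<Longrightarrow> (\<And>j. j \<in> C \<Longrightarrow> \<not> int p dvd w j) \<Longrightarrow> fourier_bound p C w \<le> \<rho>"
    and coinc: "\<And>C w. finite C \<Longrightarrow> card C = s \<Longrightarrow>
      card {x \<in> C \<times> C. int p dvd w (fst x) - w (snd x)} \<le> s * t \<Longrightarrow> fourier_bound p C w \<le> \<epsilon>"
  shows "real (card (bad_mats n p D E s \<epsilon>))
    \<le> card E ^ s * p ^ (card (D - E) + s) * (p * (3/4) ^ (card E - 1) + p ^ q * (q * \<rho>) ^ (card E - s)) * card (sym_signs n)"
proof -
  define W where "W q = {w \<in> D \<rightarrow>\<^sub>E {0..<int p}. \<exists>P V. P \<subseteq> E \<and> card P = s \<and> V \<subseteq> {0..<int p} \<and> card V = q \<and> (\<forall>j\<in>E - P. w j \<in> V)}" for q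
  define A where "A w = {M \<in> sym_signs n. \<forall>r\<in>E. int p dvd (\<Sum>j\<in>D. M r j * w j)}" for w
  let ?W1 = "{w \<in> W 1. \<exists>j\<in>D. w j \<noteq> 0}" and ?Wq = "{w \<in> W q. s \<le> card {j \<in> E. w j \<noteq> 0}}"
  have p0: "p > 0" using p by (simp add: prime_gt_0_nat)
  have finD: "finite D" using D finite_subset by blast
  have finE: "finite E" using finD E finite_subset by blast
  have finW: "finite (W q)" for q
    by (rule finite_subset[of _ "D \<rightarrow>\<^sub>E {0..<int p}"]) (auto simp: W_def intro!: finite_PiE finD)
  have nz: "\<not> int p dvd w j" if "w \<in> D \<rightarrow>\<^sub>E {0..<int p}" "j \<in> D" "w j \<noteq> 0" for w j
  proof
    assume "int p dvd w j"
    moreover have "0 \<le> w j" "w j < int p" using that(1,2) by auto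
    ultimately show False using that(3) zdvd_imp_le[of "int p" "w j"] by linarith
  qed
  \<comment> \<open>The nonzero coordinate \<open>j\<close> may lie outside \<open>E\<close>; in
    either case at least \<open>card E - 1\<close> rows remain.\<close>
  have A1: "real (card (A w)) \<le> (3/4) ^ (card E - 1) * card (sym_signs n)" if w: "w \<in> ?W1" for w
  proof -
    obtain j where j: "j \<in> D" "w j \<noteq> 0" using w by auto
    have wD: "w \<in> D \<rightarrow>\<^sub>E {0..<int p}" using w by (auto simp: W_def)
    have "card (A w) \<le> card {M \<in> sym_signs n. \<forall>r\<in>E - {j}. int p dvd (\<Sum>j\<in>D. M r j * w j)}"
      by (intro card_mono) (auto simp: A_def finite_sym_signs)
    also have "real \<dots> \<le> fourier_bound p {j} w ^ card (E - {j}) * card (sym_signs n)"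
      using j E by (intro card_rows_vanish_le p0 D) auto
    also have "fourier_bound p {j} w ^ card (E - {j}) \<le> (3/4) ^ card (E - {j})"
      using nz[OF wD j] by (intro power_mono fourier_bound_single_le p fourier_bound_nonneg) auto
    also have "(3/4 :: real) ^ card (E - {j}) \<le> (3/4) ^ (card E - 1)"
      using finE by (intro power_decreasing) (auto simp: card_Diff_singleton_if)
    finally show ?thesis by (simp add: mult_right_mono)
  qed
  have Aq: "real (card (A w)) \<le> \<rho> ^ (card E - s) * card (sym_signs n)" if w: "w \<in> ?Wq" for w
  proof -
    obtain C where C: "C \<subseteq> {j \<in> E. w j \<noteq> 0}" "card C = s"
      using w obtain_subset_with_card_n[of s "{j \<in> E. w j \<noteq> 0}"] by auto
    have CE: "C \<subseteq> E" using C by auto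
    have finC: "finite C" using CE finE finite_subset by blast
    have wD: "w \<in> D \<rightarrow>\<^sub>E {0..<int p}" using w by (auto simp: W_def)
    have "card (A w) \<le> card {M \<in> sym_signs n. \<forall>r\<in>E - C. int p dvd (\<Sum>j\<in>D. M r j * w j)}"
      by (intro card_mono) (auto simp: A_def finite_sym_signs)
    also have "real \<dots> \<le> fourier_bound p C w ^ card (E - C) * card (sym_signs n)"
      using CE E by (intro card_rows_vanish_le p0 D) auto
    also have "fourier_bound p C w ^ card (E - C) \<le> \<rho> ^ card (E - C)"
      using nz[OF wD] C E by (intro power_mono nonzero finC fourier_bound_nonneg) auto
    also have "card (E - C) = card E - s" using CE finC C by (simp add: card_Diff_subset)
    finally show ?thesis by (simp add: mult_right_mono)
  qed
  have sparse: "w \<in> ?W1" if w: "w \<in> D \<rightarrow>\<^sub>E {0..<int p}" "\<exists>j\<in>D. w j \<noteq> 0" "card {j \<in> E. w j \<noteq> 0} < s" for w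
  proof -
    \<comment> \<open>All nonzero coordinates in \<open>E\<close> go into the exceptional set, so
      off it the single value 0 suffices.\<close>
    obtain P where "{j \<in> E. w j \<noteq> 0} \<subseteq> P" "P \<subseteq> E" "card P = s"
      using exists_subset_between[of "{j \<in> E. w j \<noteq> 0}" s E] w(3) s finE by auto
    moreover have "{0} \<subseteq> {0..<int p}" "card {0::int} = 1" using p0 by auto
    ultimately have "w \<in> W 1" unfolding W_def using w(1) by blast
    then show ?thesis using w(2) by simp
  qed
  have rich: "w \<in> W q" if w: "w \<in> D \<rightarrow>\<^sub>E {0..<int p}" "fourier_bound p E w > \<epsilon>" for w
  proof -
    define m where "m v = card {i \<in> E. w i = v}" for v
    \<comment> \<open>The coordinates whose value is rare in \<open>E\<close>. If there were
      \<open>s\<close> of them they would have few coincidences, and \<open>coinc\<close> together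
      with monotonicity would contradict the concentration of \<open>w\<close>.\<close>
    define Q where "Q = {j \<in> E. m (w j) < t}"
    have finQ: "finite Q" using finE by (simp add: Q_def)
    have "card Q < s"
    proof (rule ccontr)
      assume "\<not> ?thesis"
      then obtain C where C: "C \<subseteq> Q" "card C = s" using obtain_subset_with_card_n[of s Q] by auto
      have CE: "C \<subseteq> E" using C by (auto simp: Q_def)
      have finC: "finite C" using CE finE finite_subset by blast
      have "{x \<in> C \<times> C. int p dvd w (fst x) - w (snd x)} \<subseteq> Sigma C (\<lambda>i. {j \<in> E. w j = w i})"
      proof clarsimp
        fix i j assume ij: "i \<in> C" "j \<in> C" "int p dvd w i - w j"
        then have "w i \<in> {0..<int p}" "w j \<in> {0..<int p}" using w(1) CE E by (auto simp: PiE_def Pi_def)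
        then have "w i = w j" using ij(3) by (metis atLeastLessThan_iff mod_eq_dvd_iff mod_pos_pos_trivial)
        then show "j \<in> E \<and> w j = w i" using ij CE by auto
      qed
      then have "card {x \<in> C \<times> C. int p dvd w (fst x) - w (snd x)} \<le> card (Sigma C (\<lambda>i. {j \<in> E. w j = w i}))"
        using finC finE by (intro card_mono) auto
      also have "\<dots> = (\<Sum>i\<in>C. m (w i))" using finC finE by (simp add: m_def)
      also have "\<dots> \<le> (\<Sum>i\<in>C. t)" using C by (intro sum_mono) (auto simp: Q_def)
      also have "\<dots> = s * t" using C by simp
      finally have "fourier_bound p C w \<le> \<epsilon>" by (intro coinc finC C)
      moreover have "fourier_bound p E w \<le> fourier_bound p C w" by (intro fourier_bound_antimono CE finE)
      ultimately show False using w(2) by linarith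
    qed
    then obtain P where P: "Q \<subseteq> P" "P \<subseteq> E" "card P = s"
      using exists_subset_between[of Q s E] s finE by (auto simp: Q_def)
    \<comment> \<open>Off \<open>P\<close> every value occurs at least \<open>t\<close> times in
      \<open>E\<close>, so \<open>card E < Suc q * t\<close> leaves room for at most
      \<open>q\<close> values.\<close>
    let ?V = "w ` (E - P)"
    have "card ?V * t = (\<Sum>v\<in>?V. t)" by simp
    also have "\<dots> \<le> (\<Sum>v\<in>?V. m v)" using P by (intro sum_mono) (auto simp: Q_def not_less)
    also have "\<dots> = card (\<Union>v\<in>?V. {i \<in> E. w i = v})"
      unfolding m_def using finE by (intro card_UN_disjoint[symmetric]) auto
    also have "\<dots> \<le> card E" using finE by (intro card_mono) auto
    finally have "card ?V * t < Suc q * t" using q(2) by linarith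
    then have "card ?V < Suc q" by (simp only: mult_less_cancel2)
    then have "card ?V \<le> q" by simp
    moreover have VS: "?V \<subseteq> {0..<int p}" using w(1) E by (auto simp: PiE_def Pi_def)
    ultimately obtain V where "?V \<subseteq> V" "V \<subseteq> {0..<int p}" "card V = q"
      using exists_subset_between[of ?V q "{0..<int p}"] q(1) by auto
    then show ?thesis unfolding W_def using w(1) P by blast
  qed
  have finA: "finite (A w)" for w by (simp add: A_def finite_sym_signs)
  have "bad_mats n p D E s \<epsilon> \<subseteq> (\<Union>w\<in>?W1. A w) \<union> (\<Union>w\<in>?Wq. A w)"
  proof
    fix M assume "M \<in> bad_mats n p D E s \<epsilon>"
    then obtain w where w: "w \<in> D \<rightarrow>\<^sub>E {0..<int p}" "\<exists>j\<in>D. w j \<noteq> 0" "M \<in> A w"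
      "card {j \<in> E. w j \<noteq> 0} < s \<or> fourier_bound p E w > \<epsilon>" by (auto simp: bad_mats_def A_def)
    show "M \<in> (\<Union>w\<in>?W1. A w) \<union> (\<Union>w\<in>?Wq. A w)"
    proof (cases "card {j \<in> E. w j \<noteq> 0} < s")
      case True
      then have "w \<in> ?W1" using sparse w by blast
      then show ?thesis using w(3) by blast
    next
      case False
      then have "w \<in> ?Wq" using rich w by auto
      then show ?thesis using w(3) by blast
    qed
  qed
  then have "card (bad_mats n p D E s \<epsilon>) \<le> card ((\<Union>w\<in>?W1. A w) \<union> (\<Union>w\<in>?Wq. A w))"
    using finA finW by (intro card_mono) auto
  also have "\<dots> \<le> (\<Sum>w\<in>?W1. card (A w)) + (\<Sum>w\<in>?Wq. card (A w))"
    using finA finW by (intro order_trans[OF card_Un_le] add_mono card_UN_le) auto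
  finally have "real (card (bad_mats n p D E s \<epsilon>)) \<le> (\<Sum>w\<in>?W1. real (card (A w))) + (\<Sum>w\<in>?Wq. real (card (A w)))"
    by (simp flip: of_nat_sum of_nat_add)
  also have "\<dots> \<le> (\<Sum>w\<in>?W1. (3/4) ^ (card E - 1) * card (sym_signs n)) + (\<Sum>w\<in>?Wq. \<rho> ^ (card E - s) * card (sym_signs n))"
    by (intro add_mono sum_mono A1 Aq)
  also have "\<dots> = card ?W1 * ((3/4) ^ (card E - 1) * card (sym_signs n)) + card ?Wq * (\<rho> ^ (card E - s) * card (sym_signs n))"
    by simp
  also have "\<dots> \<le> (card E ^ s * p ^ 1 * (1 ^ (card E - s) * p ^ (card (D - E) + s))) * ((3/4) ^ (card E - 1) * card (sym_signs n))
      + (card E ^ s * p ^ q * (q ^ (card E - s) * p ^ (card (D - E) + s))) * (\<rho> ^ (card E - s) * card (sym_signs n))"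
  proof (intro add_mono mult_right_mono)
    have "card ?W1 \<le> card (W 1)" using finW by (intro card_mono) auto
    also have "\<dots> \<le> card E ^ s * p ^ 1 * (1 ^ (card E - s) * p ^ (card (D - E) + s))"
      unfolding W_def by (intro card_mostly_few_values_le finD E s)
    finally show "real (card ?W1) \<le> real (card E ^ s * p ^ 1 * (1 ^ (card E - s) * p ^ (card (D - E) + s)))" by (simp only: of_nat_le_iff)
    have "card ?Wq \<le> card (W q)" using finW by (intro card_mono) auto
    also have "\<dots> \<le> card E ^ s * p ^ q * (q ^ (card E - s) * p ^ (card (D - E) + s))"
      unfolding W_def by (intro card_mostly_few_values_le finD E s)
    finally show "real (card ?Wq) \<le> real (card E ^ s * p ^ q * (q ^ (card E - s) * p ^ (card (D - E) + s)))" by (simp only: of_nat_le_iff)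
  qed (use \<rho> in auto)
  also have "\<dots> = card E ^ s * p ^ (card (D - E) + s) * (p * (3/4) ^ (card E - 1) + p ^ q * (q * \<rho>) ^ (card E - s)) * card (sym_signs n)"
    by (simp add: power_mult_distrib ring_distribs mult_ac)
  finally show ?thesis by (simp only: of_nat_power of_nat_mult)
qed

section \<open>Decoupling\<close>

text \<open>Cauchy-Schwarz over \<open>z\<close> for the number of \<open>y\<close> with
  \<open>P y z\<close>. In the second moment the diagonal pairs account for
  \<open>1 / card Y\<close> and the remaining pairs for \<open>\<epsilon>\<close>.\<close>

lemma card_decoupling_le:
  fixes \<epsilon> :: real
  assumes fin: "finite Y" "finite Z" and Y: "Y \<noteq> {}" and \<epsilon>: "\<epsilon> \<ge> 0"
    and le: "\<And>y y'. y \<in> Y \<Longrightarrow> y' \<in> Y \<Longrightarrow> y \<noteq> y' \<Longrightarrow> real (card {z \<in> Z. P y z \<and> P y' z}) \<le> \<epsilon> * card Z"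
  shows "real (card {x \<in> Y \<times> Z. P (fst x) (snd x)}) \<le> sqrt (1 / card Y + \<epsilon>) * (card Y * card Z)"
proof -
  define a where "a z = (\<Sum>y\<in>Y. if P y z then 1 else 0 :: real)" for z
  have Y0: "real (card Y) > 0" using fin Y by (simp add: card_gt_0_iff)
  have tot: "real (card {x \<in> Y \<times> Z. P (fst x) (snd x)}) = (\<Sum>z\<in>Z. a z)"
  proof -
    have "real (card {x \<in> Y \<times> Z. P (fst x) (snd x)}) = (\<Sum>x\<in>Y \<times> Z. if P (fst x) (snd x) then 1 else 0)"
      using fin by (subst sum_if_const) auto
    also have "\<dots> = (\<Sum>y\<in>Y. \<Sum>z\<in>Z. if P y z then 1 else 0)"
      by (simp add: sum.cartesian_product case_prod_unfold)
    also have "\<dots> = (\<Sum>z\<in>Z. a z)" unfolding a_def by (rule sum.swap)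
    finally show ?thesis .
  qed
  have "(\<Sum>z\<in>Z. (a z)\<^sup>2) = (\<Sum>z\<in>Z. \<Sum>y\<in>Y. \<Sum>y'\<in>Y. if P y z \<and> P y' z then 1 else 0)"
    unfolding a_def power2_eq_square sum_product by (intro sum.cong refl) auto
  also have "\<dots> = (\<Sum>y\<in>Y. \<Sum>z\<in>Z. \<Sum>y'\<in>Y. if P y z \<and> P y' z then 1 else 0)" by (rule sum.swap)
  also have "\<dots> = (\<Sum>y\<in>Y. \<Sum>y'\<in>Y. \<Sum>z\<in>Z. if P y z \<and> P y' z then 1 else 0)"
    by (intro sum.cong refl sum.swap)
  also have "\<dots> = (\<Sum>y\<in>Y. \<Sum>y'\<in>Y. real (card {z \<in> Z. P y z \<and> P y' z}))"
    using fin by (simp add: sum_if_const)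
  also have "\<dots> \<le> (\<Sum>y\<in>Y. \<Sum>y'\<in>Y. (if y = y' then real (card Z) else 0) + \<epsilon> * card Z)"
  proof (intro sum_mono)
    fix y y' assume y: "y \<in> Y" "y' \<in> Y"
    show "real (card {z \<in> Z. P y z \<and> P y' z}) \<le> (if y = y' then real (card Z) else 0) + \<epsilon> * card Z"
    proof (cases "y = y'")
      case True
      have "card {z \<in> Z. P y z \<and> P y' z} \<le> card Z" using fin by (intro card_mono) auto
      then show ?thesis using True \<epsilon> by (simp add: add_increasing2)
    qed (use le[OF y] in simp)
  qed
  also have "\<dots> = card Y * card Z * (1 + card Y * \<epsilon>)"
    using fin by (simp add: sum.distrib algebra_simps)
  finally have sq: "(\<Sum>z\<in>Z. (a z)\<^sup>2) \<le> card Y * card Z * (1 + card Y * \<epsilon>)" .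
  have "(\<Sum>z\<in>Z. a z)\<^sup>2 = (\<Sum>z\<in>Z. a z * 1)\<^sup>2" by simp
  also have "\<dots> \<le> (\<Sum>z\<in>Z. (a z)\<^sup>2) * (\<Sum>z\<in>Z. 1\<^sup>2)" by (rule Cauchy_Schwarz_ineq_sum)
  also have "\<dots> \<le> (card Y * card Z * (1 + card Y * \<epsilon>)) * card Z"
    using sq by (simp add: mult_right_mono)
  also have "\<dots> = (1 / card Y + \<epsilon>) * (card Y * card Z)\<^sup>2"
    using Y0 by (simp add: field_simps power2_eq_square)
  finally have "(\<Sum>z\<in>Z. a z) \<le> sqrt ((1 / card Y + \<epsilon>) * (card Y * card Z)\<^sup>2)" by (rule real_le_rsqrt)
  then show ?thesis unfolding tot by (simp add: real_sqrt_mult)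
qed

lemma bij_betw_PiE_Un:
  assumes "J \<inter> E = {}"
  shows "bij_betw (\<lambda>x j. if j \<in> J then fst x j else snd x j) ((J \<rightarrow>\<^sub>E S) \<times> (E \<rightarrow>\<^sub>E S)) (J \<union> E \<rightarrow>\<^sub>E S)"
proof (rule bij_betw_byWitness[where f' = "\<lambda>X. (restrict X J, restrict X E)"])
  show "\<forall>x\<in>(J \<rightarrow>\<^sub>E S) \<times> (E \<rightarrow>\<^sub>E S). (restrict (\<lambda>j. if j \<in> J then fst x j else snd x j) J,
      restrict (\<lambda>j. if j \<in> J then fst x j else snd x j) E) = x"
    using assms by (auto simp: fun_eq_iff restrict_def PiE_def extensional_def)
  show "\<forall>X\<in>J \<union> E \<rightarrow>\<^sub>E S. (\<lambda>j. if j \<in> J then fst (restrict X J, restrict X E) j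
      else snd (restrict X J, restrict X E) j) = X"
    by (auto simp: fun_eq_iff restrict_def PiE_def extensional_def)
qed (auto simp: PiE_def Pi_def extensional_def)

section \<open>The quadratic condition on a deleted column\<close>

text \<open>
  \<open>bordered_kernel p D M x a\<close> says that the matrix obtained from \<open>M\<close> on \<open>D\<close> by adding the row and
  column \<open>x\<close> with corner \<open>a\<close> has modulo \<open>p\<close> a kernel vector \<open>(v, 1)\<close>.
\<close>

definition bordered_kernel :: "nat \<Rightarrow> nat set \<Rightarrow> (nat \<Rightarrow> nat \<Rightarrow> int) \<Rightarrow> (nat \<Rightarrow> int) \<Rightarrow> int \<Rightarrow> bool" where
  "bordered_kernel p D M x a \<longleftrightarrow> (\<exists>v. (\<forall>r\<in>D. int p dvd (\<Sum>j\<in>D. M r j * v j) + x r) \<and> int p dvd (\<Sum>j\<in>D. x j * v j) + a)"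

text \<open>
  The quadratic condition on \<open>x\<close> becomes linear in \<open>x + x'\<close> when two solutions are subtracted.
\<close>

lemma bordered_kernel_difference:
  fixes M :: "nat \<Rightarrow> nat \<Rightarrow> int"
  assumes sym: "\<And>i j. M i j = M j i"
    and x: "bordered_kernel p D M x a" and x': "bordered_kernel p D M x' a"
    and w: "\<And>r. r \<in> D \<Longrightarrow> int p dvd (\<Sum>j\<in>D. M r j * w j) + (x r - x' r)"
  shows "int p dvd (\<Sum>j\<in>D. (x j + x' j) * w j)"
proof -
  define ip where "ip f g = (\<Sum>j\<in>D. f j * g j)" for f g :: "nat \<Rightarrow> int"
  define M' where "M' f r = (\<Sum>j\<in>D. M r j * f j)" for f r
  have self: "ip f (M' g) = ip g (M' f)" for f g
  proof -
    have "ip f (M' g) = (\<Sum>i\<in>D. \<Sum>j\<in>D. f i * (M i j * g j))" by (simp add: ip_def M'_def sum_distrib_left)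
    also have "\<dots> = (\<Sum>j\<in>D. \<Sum>i\<in>D. f i * (M i j * g j))" by (rule sum.swap)
    also have "\<dots> = (\<Sum>j\<in>D. \<Sum>i\<in>D. g j * (M j i * f i))"
      by (intro sum.cong refl) (simp add: sym mult_ac)
    also have "\<dots> = ip g (M' f)" by (simp add: ip_def M'_def sum_distrib_left)
    finally show ?thesis .
  qed
  have comm: "ip f g = ip g f" for f g by (simp add: ip_def mult.commute)
  have dvd: "int p dvd ip f (M' g) + ip f h" if "\<And>r. r \<in> D \<Longrightarrow> int p dvd M' g r + h r" for f g h
  proof -
    have "ip f (M' g) + ip f h = (\<Sum>j\<in>D. f j * (M' g j + h j))" by (simp add: ip_def sum.distrib ring_distribs)
    then show ?thesis using that by (simp add: dvd_sum)
  qed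
  obtain v where v: "\<And>r. r \<in> D \<Longrightarrow> int p dvd M' v r + x r" "int p dvd ip x v + a"
    using x by (auto simp: bordered_kernel_def ip_def M'_def)
  obtain v' where v': "\<And>r. r \<in> D \<Longrightarrow> int p dvd M' v' r + x' r" "int p dvd ip x' v' + a"
    using x' by (auto simp: bordered_kernel_def ip_def M'_def)
  have w': "\<And>r. r \<in> D \<Longrightarrow> int p dvd M' w r + (x r - x' r)" using w by (simp add: M'_def)
  have diff: "ip f (\<lambda>r. x r - x' r) = ip f x - ip f x'" for f
    by (simp add: ip_def sum_subtractf right_diff_distrib)
  note d = dvd[OF v(1), of w] dvd[OF v'(1), of w] dvd[OF w', of v, unfolded diff] dvd[OF w', of v', unfolded diff]
    dvd[OF v(1), of v'] dvd[OF v'(1), of v] v(2) v'(2)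
  \<comment> \<open>Modulo \<open>p\<close>, pairing \<open>w\<close> with \<open>M' v\<close> and
    \<open>M' v'\<close> and using symmetry turns the left side into
    \<open>ip v x - ip v x' + ip v' x - ip v' x'\<close>. The cross terms cancel by symmetry again,
    and \<open>ip v x\<close> and \<open>ip v' x'\<close> both equal \<open>- a\<close>. No inverse
    of the matrix is involved.\<close>
  have "ip w x + ip w x' =
      (ip w (M' v) + ip w x) + (ip w (M' v') + ip w x') - (ip v (M' w) + (ip v x - ip v x'))
      - (ip v' (M' w) + (ip v' x - ip v' x')) + (ip v' (M' v) + ip v' x) - (ip v (M' v') + ip v x')
      + (ip x v + a) - (ip x' v' + a)"
    using self[of w v] self[of w v'] self[of v v'] comm[of x v] comm[of x' v'] by linarith
  also have "int p dvd \<dots>" by (intro dvd_add dvd_diff d)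
  also have "ip w x + ip w x' = (\<Sum>j\<in>D. (x j + x' j) * w j)"
    by (simp add: ip_def sum.distrib ring_distribs mult.commute)
  finally show ?thesis .
qed

text \<open>Witnesses in \<open>bad_mats\<close> are reduced and extensional so that they can be
  counted; this converts arbitrary integer vectors to that form.\<close>

lemma exists_mod_representative:
  assumes p: "p > 0"
  obtains w where "w \<in> D \<rightarrow>\<^sub>E {0..<int p}" "\<And>j. j \<in> D \<Longrightarrow> w j = v j mod int p"
    "\<And>f. int p dvd (\<Sum>j\<in>D. f j * w j) - (\<Sum>j\<in>D. f j * v j)"
proof
  let ?w = "restrict (\<lambda>j. v j mod int p) D"
  show "?w \<in> D \<rightarrow>\<^sub>E {0..<int p}" using p by auto
  show "?w j = v j mod int p" if "j \<in> D" for j using that by simp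
  show "int p dvd (\<Sum>j\<in>D. f j * ?w j) - (\<Sum>j\<in>D. f j * v j)" for f
    unfolding sum_subtractf[symmetric]
  proof (intro dvd_sum)
    fix j assume "j \<in> D"
    then have "f j * ?w j - f j * v j = f j * (v j mod int p - v j)" by (simp add: right_diff_distrib)
    then show "int p dvd f j * ?w j - f j * v j" by (simp add: mod_eq_dvd_iff[symmetric])
  qed
qed

text \<open>Decoupling with \<open>y\<close> the signs on \<open>D - E\<close> and \<open>z\<close>
  those on \<open>E\<close>. If distinct \<open>y\<close>, \<open>y'\<close> both succeed with the
  same \<open>z\<close>, the difference of the two columns vanishes on \<open>E\<close> and is the
  image of a nonzero vector, up to sign. As \<open>M\<close> is not bad, that vector has small
  concentration on \<open>E\<close>, and \<open>z\<close> satisfies a linear equation with its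
  coefficients.\<close>

lemma card_bordered_kernel_le:
  assumes p: "prime p" "odd p" and D: "D \<subseteq> {..<n}" "i < n" "i \<notin> D" and E: "E \<subseteq> D"
    and \<epsilon>: "\<epsilon> \<ge> 0" and M: "M \<in> sym_signs n" and good: "M \<notin> bad_mats n p D E s \<epsilon>"
  shows "real (card {X \<in> D \<rightarrow>\<^sub>E {-1, 1}. bordered_kernel p D M (\<lambda>j. X j * M j i) a})
    \<le> sqrt (1 / 2 ^ card (D - E) + \<epsilon>) * 2 ^ card D"
proof -
  let ?J = "D - E"
  let ?Y = "?J \<rightarrow>\<^sub>E {-1, 1::int}" and ?Z = "E \<rightarrow>\<^sub>E {-1, 1::int}"
  define X where "X y z j = (if j \<in> ?J then y j else z j)" for y z :: "nat \<Rightarrow> int" and j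
  define x where "x y z j = X y z j * M j i" for y z j
  define P where "P y z = bordered_kernel p D M (x y z) a" for y z
  have p0: "p > 0" using p by (simp add: prime_gt_0_nat)
  have finD: "finite D" using D finite_subset by blast
  have finE: "finite E" using finD E finite_subset by blast
  have sym: "M i j = M j i" for i j using M by (simp add: sym_signs_def)
  have sgn: "M j i \<in> {-1, 1}" if "j \<in> D" for j using M that D unfolding sym_signs_def by blast
  have bij: "bij_betw (\<lambda>x. X (fst x) (snd x)) (?Y \<times> ?Z) (D \<rightarrow>\<^sub>E {-1, 1})"
  proof -
    have "?J \<inter> E = {}" "?J \<union> E = D" "X y z = (\<lambda>j. if j \<in> ?J then y j else z j)" for y z
      using E by (auto simp: X_def)
    then show ?thesis using bij_betw_PiE_Un[of ?J E "{-1, 1}"] by simp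
  qed
  have P_iff: "P y z \<longleftrightarrow> bordered_kernel p D M (\<lambda>j. X y z j * M j i) a" for y z
    by (simp add: P_def x_def[abs_def])
  have "card {X \<in> D \<rightarrow>\<^sub>E {-1, 1}. bordered_kernel p D M (\<lambda>j. X j * M j i) a}
      = card {x \<in> ?Y \<times> ?Z. P (fst x) (snd x)}"
    unfolding P_iff by (rule card_Collect_bij_betw[OF bij])
  also have "real \<dots> \<le> sqrt (1 / card ?Y + \<epsilon>) * (card ?Y * card ?Z)"
  proof (rule card_decoupling_le)
    show "finite ?Y" "finite ?Z" using finD finE by (auto intro!: finite_PiE)
    show "?Y \<noteq> {}" by (auto simp: PiE_eq_empty_iff)
    show "\<epsilon> \<ge> 0" by fact
    fix y y' assume y: "y \<in> ?Y" "y' \<in> ?Y" "y \<noteq> y'"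
    let ?S = "{z \<in> ?Z. P y z \<and> P y' z}"
    show "real (card ?S) \<le> \<epsilon> * card ?Z"
    proof (cases "?S = {}")
      case True
      show ?thesis unfolding True using \<epsilon> by simp
    next
      case False
      \<comment> \<open>One success \<open>z0\<close> fixes the vector \<open>w\<close> for every
        \<open>z\<close>, because the difference \<open>u\<close> of the two columns does not depend
        on \<open>z\<close>.\<close>
      then obtain z0 where z0: "P y z0" "P y' z0" by auto
      define u where "u r = x y z0 r - x y' z0 r" for r
      have u: "x y z r - x y' z r = u r" for z r by (auto simp: u_def x_def X_def)
      have uE: "u r = 0" if "r \<in> E" for r using that by (simp add: u_def x_def X_def)
      obtain v where v: "\<And>r. r \<in> D \<Longrightarrow> int p dvd (\<Sum>j\<in>D. M r j * v j) + x y z0 r"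
        using z0(1) by (auto simp: P_def bordered_kernel_def)
      obtain v' where v': "\<And>r. r \<in> D \<Longrightarrow> int p dvd (\<Sum>j\<in>D. M r j * v' j) + x y' z0 r"
        using z0(2) by (auto simp: P_def bordered_kernel_def)
      obtain w where w: "w \<in> D \<rightarrow>\<^sub>E {0..<int p}"
        and wmod: "\<And>f. int p dvd (\<Sum>j\<in>D. f j * w j) - (\<Sum>j\<in>D. f j * (v j - v' j))"
        using exists_mod_representative[OF p0] by metis
      have Mw: "int p dvd (\<Sum>j\<in>D. M r j * w j) + u r" if "r \<in> D" for r
      proof -
        have "(\<Sum>j\<in>D. M r j * w j) + u r = ((\<Sum>j\<in>D. M r j * w j) - (\<Sum>j\<in>D. M r j * (v j - v' j)))
          + (((\<Sum>j\<in>D. M r j * v j) + x y z0 r) - ((\<Sum>j\<in>D. M r j * v' j) + x y' z0 r))"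
          by (simp add: u_def sum_subtractf right_diff_distrib)
        also have "int p dvd \<dots>" by (intro dvd_add dvd_diff wmod v v' that)
        finally show ?thesis .
      qed
      have "\<exists>j\<in>D. w j \<noteq> 0"
      proof (rule ccontr)
        assume neg: "\<not> ?thesis"
        \<comment> \<open>Where \<open>y\<close> and \<open>y'\<close> differ, \<open>u r\<close> is
          2 or -2, which is nonzero modulo the odd prime; so \<open>w\<close> cannot vanish.\<close>
        obtain r where r: "r \<in> ?J" "y r \<noteq> y' r" using y by (metis PiE_ext)
        have "y r \<in> {-1, 1}" "y' r \<in> {-1, 1}" using y r by auto
        moreover have "u r = (y r - y' r) * M r i" using r by (simp add: u_def x_def X_def left_diff_distrib)
        ultimately have "u r = 2 * 1 \<or> u r = 2 * (- 1)" using r sgn[of r] by auto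
        moreover have "int p dvd u r" using Mw[of r] neg r by simp
        moreover have "\<not> int p dvd 1" "\<not> int p dvd - 1" using p by (auto simp: prime_nat_iff)
        ultimately show False using odd_prime_dvd_double_iff[OF p] by metis
      qed
      moreover have "int p dvd (\<Sum>j\<in>D. M r j * w j)" if "r \<in> E" for r
        using Mw[of r] uE[OF that] E that by auto
      ultimately have fb: "fourier_bound p E w \<le> \<epsilon>"
        using good M w unfolding bad_mats_def by (auto simp: not_less)
      \<comment> \<open>On \<open>D - E\<close> the sum \<open>y j + y' j\<close> is even, and on
        \<open>E\<close> the sign \<open>z j\<close> appears twice. A common factor 2 can therefore
        be cancelled modulo \<open>p\<close>, and \<open>c\<close> is independent of
        \<open>z\<close>.\<close>
      define c where "c = - (\<Sum>j\<in>?J. ((y j + y' j) div 2) * M j i * w j)"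
      have "?S \<subseteq> {z \<in> ?Z. int p dvd (\<Sum>j\<in>E. z j * (M j i * w j)) - c}"
      proof safe
        fix z assume z: "P y z" "P y' z"
        have "int p dvd (\<Sum>j\<in>D. (x y z j + x y' z j) * w j)"
          by (rule bordered_kernel_difference[of M p D "x y z" a "x y' z"])
            (use z Mw in \<open>simp_all add: P_def u sym\<close>)
        also have "(\<Sum>j\<in>D. (x y z j + x y' z j) * w j) =
            (\<Sum>j\<in>?J. (x y z j + x y' z j) * w j) + (\<Sum>j\<in>E. (x y z j + x y' z j) * w j)"
          using E finD by (rule sum.subset_diff)
        also have "(\<Sum>j\<in>?J. (x y z j + x y' z j) * w j) = 2 * (- c)"
          unfolding c_def minus_minus sum_distrib_left
        proof (intro sum.cong refl)
          fix j assume j: "j \<in> ?J"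
          have "y j \<in> {-1, 1}" "y' j \<in> {-1, 1}" using y j by auto
          then have "y j + y' j = 2 * ((y j + y' j) div 2)" by auto
          then have "(y j + y' j) * (M j i * w j) = 2 * ((y j + y' j) div 2) * (M j i * w j)" by (rule arg_cong)
          moreover have "x y z j + x y' z j = (y j + y' j) * M j i" using j by (simp add: x_def X_def ring_distribs)
          ultimately show "(x y z j + x y' z j) * w j = 2 * ((y j + y' j) div 2 * M j i * w j)" by (simp only: mult_ac)
        qed
        also have "(\<Sum>j\<in>E. (x y z j + x y' z j) * w j) = 2 * (\<Sum>j\<in>E. z j * (M j i * w j))"
          unfolding sum_distrib_left by (intro sum.cong refl) (simp add: x_def X_def)
        also have "2 * (- c) + 2 * (\<Sum>j\<in>E. z j * (M j i * w j)) = 2 * ((\<Sum>j\<in>E. z j * (M j i * w j)) - c)" by simp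
        finally show "int p dvd (\<Sum>j\<in>E. z j * (M j i * w j)) - c"
          using odd_prime_dvd_double_iff[OF p] by blast
      qed
      then have "card ?S \<le> card {z \<in> ?Z. int p dvd (\<Sum>j\<in>E. z j * (M j i * w j)) - c}"
        using finE by (intro card_mono) (auto intro!: finite_PiE)
      also have "real \<dots> \<le> fourier_bound p E (\<lambda>j. M j i * w j) * 2 ^ card E"
        by (rule card_signed_sums_le[OF p0 finE])
      also have "fourier_bound p E (\<lambda>j. M j i * w j) = fourier_bound p E w"
      proof (rule fourier_bound_cong)
        fix j assume "j \<in> E"
        then have "M j i \<in> {-1, 1}" using sgn E by auto
        then show "\<bar>M j i * w j\<bar> = \<bar>w j\<bar>" by auto
      qed
      also have "fourier_bound p E w * 2 ^ card E \<le> \<epsilon> * card ?Z"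
        using fb finE by (simp add: card_PiE)
      finally show ?thesis by simp
    qed
  qed
  also have "\<dots> = sqrt (1 / 2 ^ card (D - E) + \<epsilon>) * 2 ^ card D"
  proof -
    have "card D = card ?J + card E" using E finD by (simp add: card_Diff_subset finE card_mono)
    then show ?thesis using finD finE by (simp add: card_PiE power_add)
  qed
  finally show ?thesis .
qed

section \<open>From one deleted column to all singular matrices\<close>

definition kernel_mod :: "nat \<Rightarrow> nat \<Rightarrow> (nat \<Rightarrow> nat \<Rightarrow> int) \<Rightarrow> (nat \<Rightarrow> int) set" where
  "kernel_mod n p M = {v. \<forall>r<n. int p dvd (\<Sum>j<n. M r j * v j)}"

text \<open>Badness depends only on the entries in \<open>D \<times> D\<close>, so resampling row
  and column \<open>i\<close> outside \<open>D\<close> does not affect it.\<close>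

lemma bad_mats_cong:
  assumes "\<And>r j. r \<in> D \<Longrightarrow> j \<in> D \<Longrightarrow> M r j = M' r j" and "E \<subseteq> D" and "M \<in> sym_signs n" "M' \<in> sym_signs n"
  shows "M \<in> bad_mats n p D E s \<epsilon> \<longleftrightarrow> M' \<in> bad_mats n p D E s \<epsilon>"
proof -
  have "(\<Sum>j\<in>D. M r j * w j) = (\<Sum>j\<in>D. M' r j * w j)" if "r \<in> E" for r w
    using assms that by (intro sum.cong) auto
  then show ?thesis using assms(3,4) by (simp add: bad_mats_def)
qed

text \<open>The off-diagonal part of row and column \<open>i\<close> is resampled with all other
  entries fixed. A kernel vector with \<open>v i\<close> invertible modulo \<open>p\<close> can be
  scaled to \<open>v i = 1\<close>, which is exactly a bordered kernel vector for the remaining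
  matrix.\<close>

lemma card_kernel_coordinate_le:
  assumes p: "prime p" "odd p" and i: "i < n" and D: "D = {..<n} - {i}" and E: "E \<subseteq> D" and \<epsilon>: "\<epsilon> \<ge> 0"
  shows "real (card {M \<in> sym_signs n. (\<exists>v\<in>kernel_mod n p M. \<not> int p dvd v i) \<and> M \<notin> bad_mats n p D E s \<epsilon>})
    \<le> sqrt (1 / 2 ^ card (D - E) + \<epsilon>) * card (sym_signs n)"
proof -
  let ?X = "D \<rightarrow>\<^sub>E {-1, 1::int}"
  define S where "S X a b = (if a = i \<and> b \<in> D then X b else if b = i \<and> a \<in> D then X a else 1)"
    for X :: "nat \<Rightarrow> int" and a b
  have finD: "finite D" and iD: "i \<notin> D" and Dn: "D \<subseteq> {..<n}" using D by auto
  have S: "S X a b = S X b a" "S X a b \<in> {-1, 1}" if "X \<in> ?X" for X a b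
    using that iD by (auto simp: S_def)
  have split: "(\<Sum>j<n. f j) = (\<Sum>j\<in>D. f j) + f i" for f :: "nat \<Rightarrow> int"
    using i unfolding D by (simp add: sum.remove[of "{..<n}" i])
  show ?thesis
  proof (rule card_le_average[where X = ?X and act = "\<lambda>X M a b. S X a b * M a b"])
    show "finite (sym_signs n)" by (rule finite_sym_signs)
    show "finite ?X" using finD by (intro finite_PiE) auto
    show "?X \<noteq> {}" by (auto simp: PiE_eq_empty_iff)
    show bij: "bij_betw (\<lambda>M a b. S X a b * M a b) (sym_signs n) (sym_signs n)" if "X \<in> ?X" for X
      using S[OF that] by (intro bij_betw_sign_flip) auto
    fix M assume M: "M \<in> sym_signs n"
    let ?T = "{X \<in> ?X. (\<exists>v\<in>kernel_mod n p (\<lambda>a b. S X a b * M a b). \<not> int p dvd v i)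
      \<and> (\<lambda>a b. S X a b * M a b) \<notin> bad_mats n p D E s \<epsilon>}"
    have bad_iff: "(\<lambda>a b. S X a b * M a b) \<in> bad_mats n p D E s \<epsilon> \<longleftrightarrow> M \<in> bad_mats n p D E s \<epsilon>" if "X \<in> ?X" for X
    proof (rule bad_mats_cong[OF _ E _ M])
      show "(\<lambda>a b. S X a b * M a b) \<in> sym_signs n" using bij[OF that] M by (auto simp: bij_betw_def)
      show "S X r j * M r j = M r j" if "r \<in> D" "j \<in> D" for r j using that iD by (auto simp: S_def)
    qed
    show "real (card ?T) \<le> sqrt (1 / 2 ^ card (D - E) + \<epsilon>) * real (card ?X)"
    proof (cases "M \<in> bad_mats n p D E s \<epsilon>")
      case True
      then have "?T = {}" using bad_iff by blast
      then show ?thesis using \<epsilon> by (simp only: card.empty) simp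
    next
      case False
      have "?T \<subseteq> {X \<in> ?X. bordered_kernel p D M (\<lambda>j. X j * M j i) (M i i)}"
      proof safe
        fix X v assume X: "X \<in> ?X" and v: "v \<in> kernel_mod n p (\<lambda>a b. S X a b * M a b)" and vi: "\<not> int p dvd v i"
        have "coprime (v i) (int p)" using vi p(1) by (meson coprime_commute prime_imp_coprime prime_nat_int_transfer)
        then obtain u where u: "[v i * u = 1] (mod int p)" using cong_solve_coprime_int by blast
        then have u1: "int p dvd v i * u - 1" by (simp add: cong_iff_dvd_diff)
        have row: "int p dvd u * (\<Sum>j<n. S X r j * M r j * v j)" if "r < n" for r
          using v that by (simp add: kernel_mod_def)
        have sym: "M a b = M b a" for a b using M by (simp add: sym_signs_def)
        show "bordered_kernel p D M (\<lambda>j. X j * M j i) (M i i)"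
          unfolding bordered_kernel_def
        proof (intro exI[of _ "\<lambda>j. u * v j"] conjI ballI)
          fix r assume r: "r \<in> D"
          have "u * (\<Sum>j<n. S X r j * M r j * v j) = (\<Sum>j\<in>D. M r j * (u * v j)) + X r * M r i * (v i * u)"
          proof -
            have "(\<Sum>j\<in>D. S X r j * M r j * v j) = (\<Sum>j\<in>D. M r j * v j)"
              using r iD by (intro sum.cong) (auto simp: S_def)
            moreover have "S X r i = X r" using r iD by (auto simp: S_def)
            ultimately show ?thesis by (simp add: split ring_distribs sum_distrib_left mult_ac)
          qed
          then have "(\<Sum>j\<in>D. M r j * (u * v j)) + X r * M r i =
              u * (\<Sum>j<n. S X r j * M r j * v j) - X r * M r i * (v i * u - 1)" by (simp add: algebra_simps)
          also have "int p dvd \<dots>" using row[of r] r Dn by (intro dvd_diff dvd_mult[OF u1]) auto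
          finally show "int p dvd (\<Sum>j\<in>D. M r j * (u * v j)) + X r * M r i" .
        next
          have "u * (\<Sum>j<n. S X i j * M i j * v j) = (\<Sum>j\<in>D. X j * M j i * (u * v j)) + M i i * (v i * u)"
          proof -
            have "(\<Sum>j\<in>D. S X i j * M i j * v j) = (\<Sum>j\<in>D. X j * M j i * v j)"
              by (intro sum.cong) (auto simp: S_def sym[of i])
            moreover have "S X i i = 1" using iD by (auto simp: S_def)
            ultimately show ?thesis by (simp add: split ring_distribs sum_distrib_left mult_ac)
          qed
          then have "(\<Sum>j\<in>D. X j * M j i * (u * v j)) + M i i =
              u * (\<Sum>j<n. S X i j * M i j * v j) - M i i * (v i * u - 1)" by (simp add: algebra_simps)
          also have "int p dvd \<dots>" using row[OF i] by (intro dvd_diff dvd_mult[OF u1]) auto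
          finally show "int p dvd (\<Sum>j\<in>D. X j * M j i * (u * v j)) + M i i" .
        qed
      qed
      then have "card ?T \<le> card {X \<in> ?X. bordered_kernel p D M (\<lambda>j. X j * M j i) (M i i)}"
        using finD by (intro card_mono) (auto intro!: finite_PiE)
      also have "real \<dots> \<le> sqrt (1 / 2 ^ card (D - E) + \<epsilon>) * 2 ^ card D"
        by (rule card_bordered_kernel_le[OF p Dn i iD E \<epsilon> M False])
      also have "\<dots> = sqrt (1 / 2 ^ card (D - E) + \<epsilon>) * real (card ?X)" using finD by (simp add: card_PiE)
      finally show ?thesis by simp
    qed
  qed
qed

text \<open>
  A kernel vector of a matrix outside \<^term>\<open>bad_mats n p {..<n} {..<n} s \<epsilon>\<close> has at least \<open>s\<close> nonzero
  coordinates, so the union over the coordinates \<open>i\<close> is overcounted at least \<open>s\<close> times.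
\<close>

lemma card_singular_mod_le:
  fixes \<beta> :: real
  assumes p: "prime p" "odd p" and s: "s > 0" and \<epsilon>: "\<epsilon> \<ge> 0"
    and E: "\<And>i. i < n \<Longrightarrow> E i \<subseteq> {..<n} - {i}" "\<And>i. i < n \<Longrightarrow> card ({..<n} - {i} - E i) = K"
    and bad0: "real (card (bad_mats n p {..<n} {..<n} s \<epsilon>)) \<le> \<beta> * card (sym_signs n)"
    and bad: "\<And>i. i < n \<Longrightarrow> real (card (bad_mats n p ({..<n} - {i}) (E i) s \<epsilon>)) \<le> \<beta> * card (sym_signs n)"
  shows "real (card {M \<in> sym_signs n. \<exists>v\<in>kernel_mod n p M. \<exists>j<n. \<not> int p dvd v j})
    \<le> (\<beta> + n / s * (\<beta> + sqrt (1 / 2 ^ K + \<epsilon>))) * card (sym_signs n)"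
proof -
  let ?N = "real (card (sym_signs n))" and ?\<delta> = "sqrt (1 / 2 ^ K + \<epsilon>)"
  let ?B = "bad_mats n p {..<n} {..<n} s \<epsilon>"
  let ?S = "{M \<in> sym_signs n. \<exists>v\<in>kernel_mod n p M. \<exists>j<n. \<not> int p dvd v j}"
  let ?K = "\<lambda>M i. \<exists>v\<in>kernel_mod n p M. \<not> int p dvd v i"
  have p0: "p > 0" using p by (simp add: prime_gt_0_nat)
  have fin: "finite ?S" by (simp add: finite_sym_signs)
  have many: "s \<le> card {i \<in> {..<n}. ?K M i}" if M: "M \<in> ?S - ?B" for M
  proof -
    obtain v j where v: "v \<in> kernel_mod n p M" "j < n" "\<not> int p dvd v j" using M by auto
    obtain w where w: "w \<in> {..<n} \<rightarrow>\<^sub>E {0..<int p}" "\<And>j. j < n \<Longrightarrow> w j = v j mod int p"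
      and wmod: "\<And>f. int p dvd (\<Sum>j<n. f j * w j) - (\<Sum>j<n. f j * v j)"
      using exists_mod_representative[OF p0, of "{..<n}" v] by (metis lessThan_iff)
    have "int p dvd (\<Sum>j<n. M r j * w j)" if "r < n" for r
    proof -
      have "int p dvd (\<Sum>j<n. M r j * v j)" using v that by (simp add: kernel_mod_def)
      then have "int p dvd ((\<Sum>j<n. M r j * w j) - (\<Sum>j<n. M r j * v j)) + (\<Sum>j<n. M r j * v j)"
        by (intro dvd_add wmod)
      then show ?thesis by simp
    qed
    then have dvd: "\<forall>r\<in>{..<n}. int p dvd (\<Sum>j<n. M r j * w j)" by simp
    have "w j \<noteq> 0" using w(2)[OF v(2)] v(3) by (simp add: dvd_eq_mod_eq_0)
    then have nz: "\<exists>j\<in>{..<n}. w j \<noteq> 0" using v(2) by auto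
    have "s \<le> card {j \<in> {..<n}. w j \<noteq> 0}"
    proof (rule ccontr)
      assume "\<not> ?thesis"
      then have "card {j \<in> {..<n}. w j \<noteq> 0} < s \<or> fourier_bound p {..<n} w > \<epsilon>" by simp
      with w(1) nz dvd M have "M \<in> ?B" unfolding bad_mats_def by blast
      then show False using M by blast
    qed
    also have "\<dots> \<le> card {i \<in> {..<n}. ?K M i}"
      using v(1) w(2) by (intro card_mono) (auto simp: dvd_eq_mod_eq_0 intro!: bexI[of _ v])
    finally show ?thesis .
  qed
  have one: "real (card {M \<in> sym_signs n. ?K M i}) \<le> (\<beta> + ?\<delta>) * ?N" if i: "i < n" for i
  proof -
    let ?Bi = "bad_mats n p ({..<n} - {i}) (E i) s \<epsilon>"
    have "card {M \<in> sym_signs n. ?K M i} \<le> card (?Bi \<union> {M \<in> sym_signs n. ?K M i \<and> M \<notin> ?Bi})"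
      by (intro card_mono) (auto simp: bad_mats_def finite_sym_signs)
    also have "\<dots> \<le> card ?Bi + card {M \<in> sym_signs n. ?K M i \<and> M \<notin> ?Bi}" by (rule card_Un_le)
    finally show ?thesis
      using bad[OF i] card_kernel_coordinate_le[OF p i refl E(1)[OF i] \<epsilon>, of s] unfolding E(2)[OF i]
      by (simp add: ring_distribs)
  qed
  have "s * card (?S - ?B) = (\<Sum>M\<in>?S - ?B. s)" by simp
  also have "\<dots> \<le> (\<Sum>M\<in>?S - ?B. card {i \<in> {..<n}. ?K M i})" by (intro sum_mono many)
  also have "\<dots> \<le> (\<Sum>M\<in>sym_signs n. card {i \<in> {..<n}. ?K M i})"
    by (intro sum_mono2 finite_sym_signs) auto
  also have "\<dots> = (\<Sum>M\<in>sym_signs n. \<Sum>i<n. if ?K M i then 1 else 0)"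
    by (simp add: sum_if_const)
  also have "\<dots> = (\<Sum>i<n. \<Sum>M\<in>sym_signs n. if ?K M i then 1 else 0)" by (rule sum.swap)
  also have "\<dots> = (\<Sum>i<n. card {M \<in> sym_signs n. ?K M i})" by (simp add: sum_if_const finite_sym_signs)
  finally have "real s * card (?S - ?B) \<le> (\<Sum>i<n. real (card {M \<in> sym_signs n. ?K M i}))"
    by (simp flip: of_nat_mult of_nat_sum)
  also have "\<dots> \<le> (\<Sum>i<n. (\<beta> + ?\<delta>) * ?N)" by (intro sum_mono one) auto
  finally have "real (card (?S - ?B)) \<le> n / s * (\<beta> + ?\<delta>) * ?N" using s by (simp add: field_simps)
  moreover have "card ?S \<le> card (?S - ?B) + card ?B"
  proof -
    have "card ?S \<le> card ((?S - ?B) \<union> ?B)"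
      using fin by (intro card_mono) (auto simp: bad_mats_def finite_sym_signs)
    also have "\<dots> \<le> card (?S - ?B) + card ?B" by (rule card_Un_le)
    finally show ?thesis .
  qed
  ultimately have "real (card ?S) \<le> n / s * (\<beta> + ?\<delta>) * ?N + \<beta> * ?N" using bad0 by linarith
  then show ?thesis by (simp add: ring_distribs)
qed

text \<open>A real singular integer matrix has a nonzero integer kernel vector. Dividing it by
  \<open>p\<close> while all coordinates are multiples of \<open>p\<close> decreases the sum of
  their absolute values, so the process ends at a vector that is nonzero modulo
  \<open>p\<close>.\<close>

lemma exists_kernel_mod_of_det_0:
  assumes p: "prime p" and det: "Determinant.det (Matrix.mat n n (\<lambda>(i, j). real_of_int (M i j))) = 0"
  shows "\<exists>v\<in>kernel_mod n p M. \<exists>j<n. \<not> int p dvd v j"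
proof -
  let ?A = "Matrix.mat n n (\<lambda>(i, j). M i j)"
  have "Matrix.mat n n (\<lambda>(i, j). real_of_int (M i j)) = map_mat of_int ?A" by (intro eq_matI) auto
  then have "real_of_int (Determinant.det ?A) = 0" using det by (simp add: of_int_hom.hom_det)
  then have "Determinant.det ?A = 0" by simp
  then obtain x where x: "x \<in> carrier_vec n" "x \<noteq> 0\<^sub>v n" "?A *\<^sub>v x = 0\<^sub>v n"
    using det_0_iff_vec_prod_zero[of ?A n] by auto
  have zero: "(\<Sum>j<n. M r j * x $ j) = 0" if "r < n" for r
  proof -
    have "(\<Sum>j<n. M r j * x $ j) = (?A *\<^sub>v x) $ r"
      using that x(1) by (simp add: scalar_prod_def atLeast0LessThan)
    then show ?thesis using x(3) that by simp
  qed
  have "\<exists>j<n. x $ j \<noteq> 0"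
  proof (rule ccontr)
    assume "\<not> ?thesis"
    then have "x = 0\<^sub>v n" using x(1) by (intro eq_vecI) auto
    then show False using x(2) by simp
  qed
  moreover have "\<exists>v\<in>kernel_mod n p M. \<exists>j<n. \<not> int p dvd v j"
    if "\<forall>r<n. (\<Sum>j<n. M r j * v j) = 0" "\<exists>j<n. v j \<noteq> 0" for v :: "nat \<Rightarrow> int"
    using that
  proof (induction "\<Sum>j<n. nat \<bar>v j\<bar>" arbitrary: v rule: less_induct)
    case less
    show ?case
    proof (cases "\<exists>j<n. \<not> int p dvd v j")
      case True
      then show ?thesis using less.prems(1) by (intro bexI[of _ v]) (auto simp: kernel_mod_def)
    next
      case False
      define u where "u j = v j div int p" for j
      have v: "v j = int p * u j" if "j < n" for j using False that by (simp add: u_def)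
      have p1: "p > 1" using p by (rule prime_gt_1_nat)
      have "\<forall>r<n. (\<Sum>j<n. M r j * u j) = 0"
      proof (intro allI impI)
        fix r assume "r < n"
        then have "0 = (\<Sum>j<n. M r j * v j)" using less.prems(1) by simp
        also have "\<dots> = int p * (\<Sum>j<n. M r j * u j)" by (simp add: v sum_distrib_left mult_ac)
        finally show "(\<Sum>j<n. M r j * u j) = 0" using p1 by simp
      qed
      moreover obtain k where k: "k < n" "v k \<noteq> 0" using less.prems(2) by auto
      moreover have "u k \<noteq> 0" using k v by auto
      moreover have "(\<Sum>j<n. nat \<bar>u j\<bar>) < (\<Sum>j<n. nat \<bar>v j\<bar>)"
      proof (rule sum_strict_mono_ex1)
        have abs: "nat \<bar>v j\<bar> = p * nat \<bar>u j\<bar>" if "j < n" for j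
          using v[OF that] by (simp add: abs_mult nat_mult_distrib)
        then show "\<forall>j\<in>{..<n}. nat \<bar>u j\<bar> \<le> nat \<bar>v j\<bar>" using p1 by simp
        show "\<exists>j\<in>{..<n}. nat \<bar>u j\<bar> < nat \<bar>v j\<bar>"
          using abs[OF k(1)] k(1) p1 \<open>u k \<noteq> 0\<close> by (intro bexI[of _ k]) auto
      qed auto
      ultimately show ?thesis using less.hyps[of u] by blast
    qed
  qed
  ultimately show ?thesis using zero by blast
qed

lemma singular_prob_le:
  assumes "prime p"
  shows "singular_prob n \<le> card {M \<in> sym_signs n. \<exists>v\<in>kernel_mod n p M. \<exists>j<n. \<not> int p dvd v j} / card (sym_signs n)"
proof -
  let ?f = "\<lambda>M. Matrix.mat n n (\<lambda>(i, j). real_of_int (M i j))"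
  have "singular_prob n = card {A \<in> sym_sign_mats n. Determinant.det A = 0} / card (sym_sign_mats n)"
    unfolding singular_prob_def
    by (subst measure_pmf_of_set[OF sym_sign_mats_nonempty finite_sym_sign_mats]) (simp add: Int_def)
  also have "card {A \<in> sym_sign_mats n. Determinant.det A = 0} = card {M \<in> sym_signs n. Determinant.det (?f M) = 0}"
    by (rule card_Collect_bij_betw[OF bij_betw_sym_signs_mats])
  also have "card (sym_sign_mats n) = card (sym_signs n)"
    using bij_betw_same_card[OF bij_betw_sym_signs_mats] by simp
  also have "card {M \<in> sym_signs n. Determinant.det (?f M) = 0} / card (sym_signs n)
      \<le> card {M \<in> sym_signs n. \<exists>v\<in>kernel_mod n p M. \<exists>j<n. \<not> int p dvd v j} / card (sym_signs n)"
    using exists_kernel_mod_of_det_0[OF assms]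
    by (intro divide_right_mono) (auto simp: finite_sym_signs intro!: card_mono)
  finally show ?thesis .
qed

section \<open>Choice of parameters\<close>

lemma power_eq_exp_ln: "x > 0 \<Longrightarrow> x ^ k = exp (real k * ln x)" for x :: real
  by (simp add: exp_of_nat_mult)

text \<open>The estimate for \<open>card_bad_mats_le\<close> with \<open>m\<close> for
  \<open>card E\<close> and \<open>d\<close> for \<open>card (D - E)\<close>. Both exponents of the
  small factors are at least \<open>e\<close>, and everything else is absorbed into a power of
  \<open>n\<close> through \<open>p \<le> n ^ 2\<close>.\<close>

lemma union_bound_le:
  fixes n p q s K m d e :: nat and \<rho> :: real
  assumes n: "n > 0" and p: "p \<le> n ^ 2" "p > 0" and m: "m \<le> n" "n \<le> m + 1 + K" and d: "d \<le> K"
    and e: "e + 2 + K + s = n" and \<rho>: "\<rho> \<ge> 0" "q * \<rho> \<le> 3 / 4"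
  shows "real (m ^ s * p ^ (d + s)) * (p * (3/4) ^ (m - 1) + real p ^ q * (q * \<rho>) ^ (m - s))
    \<le> exp ((3 * s + 2 * K + 2 * q + 2) * ln n + ln 2 - e * ln (4 / 3))"
proof -
  have n1: "real n \<ge> 1" using n by simp
  have pn: "real p ^ k \<le> real n ^ (2 * k)" for k
  proof -
    have "p ^ k \<le> (n ^ 2) ^ k" by (intro power_mono p) auto
    then have "real (p ^ k) \<le> real ((n ^ 2) ^ k)" by (simp only: of_nat_le_iff)
    then show ?thesis by (simp add: power_mult)
  qed
  have "real (m ^ s * p ^ (d + s)) \<le> real n ^ s * real n ^ (2 * (K + s))"
  proof -
    have "real p ^ (d + s) \<le> real p ^ (K + s)" using d p by (intro power_increasing) auto
    also note pn
    finally show ?thesis using m(1) by (auto intro!: mult_mono power_mono)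
  qed
  also have "\<dots> = real n ^ (3 * s + 2 * K)" by (simp flip: power_add)
  finally have 1: "real (m ^ s * p ^ (d + s)) \<le> real n ^ (3 * s + 2 * K)" .
  have "p * (3/4::real) ^ (m - 1) \<le> real n ^ (2 * q + 2) * (3/4) ^ e"
  proof (rule mult_mono)
    have "real p \<le> real n ^ 2" using pn[of 1] by simp
    also have "\<dots> \<le> real n ^ (2 * q + 2)" using n1 by (intro power_increasing) auto
    finally show "real p \<le> real n ^ (2 * q + 2)" .
    show "(3/4::real) ^ (m - 1) \<le> (3/4) ^ e" using m e by (intro power_decreasing) auto
  qed auto
  moreover have "real p ^ q * (q * \<rho>) ^ (m - s) \<le> real n ^ (2 * q + 2) * (3/4) ^ e"
  proof (rule mult_mono)
    have "real n ^ (2 * q) \<le> real n ^ (2 * q + 2)" using n1 by (intro power_increasing) auto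
    with pn[of q] show "real p ^ q \<le> real n ^ (2 * q + 2)" by linarith
    have "(q * \<rho>) ^ (m - s) \<le> (3/4) ^ (m - s)" using \<rho> by (intro power_mono) auto
    also have "\<dots> \<le> (3/4) ^ e" using m e by (intro power_decreasing) auto
    finally show "(q * \<rho>) ^ (m - s) \<le> (3/4) ^ e" .
  qed (use \<rho> in auto)
  ultimately have 2: "p * (3/4) ^ (m - 1) + real p ^ q * (q * \<rho>) ^ (m - s) \<le> 2 * (real n ^ (2 * q + 2) * (3/4) ^ e)"
    by linarith
  have "real (m ^ s * p ^ (d + s)) * (p * (3/4) ^ (m - 1) + real p ^ q * (q * \<rho>) ^ (m - s))
      \<le> real n ^ (3 * s + 2 * K) * (2 * (real n ^ (2 * q + 2) * (3/4) ^ e))"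
    using \<rho> by (intro mult_mono 1 2) auto
  also have "\<dots> = real n ^ (3 * s + 2 * K + 2 * q + 2) * 2 * (3/4) ^ e" by (simp add: power_add mult_ac)
  also have "\<dots> = exp (real (3 * s + 2 * K + 2 * q + 2) * ln n) * exp (ln 2) * exp (e * ln (3/4))"
    using n by (simp only: power_eq_exp_ln[of "real n"] power_eq_exp_ln[of "3/4"]) simp
  also have "ln (3/4 :: real) = - ln (4/3)" by (simp add: ln_div)
  finally show ?thesis by (simp add: exp_add exp_diff exp_minus field_simps)
qed

text \<open>With \<open>L = ln n\<close>, Littlewood-Offord on \<open>s\<close> coordinates gives
  order \<open>L powr (3/2) / sqrt n\<close>, below \<open>\<rho>\<close>, and
  \<open>q * \<rho>\<close> is at most about \<open>1 / L\<close>. The pair bound gives order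
  \<open>L powr (13/2) / n\<close>, below \<open>\<epsilon>\<close>. The union bound costs only
  \<open>exp (O(n / L))\<close>, which \<open>(3/4) ^ e\<close> beats.\<close>

lemma eventually_singular_prob_le:
  "\<forall>\<^sub>F n in sequentially. singular_prob n \<le> ln (real n) ^ 6 / sqrt (real n)"
proof -
  have "\<forall>\<^sub>F n::nat in sequentially. 1 / n + 24 * sqrt (ln n) / sqrt (n / (2 * ln n ^ 2)) + 1 / n ^ 2 \<le> ln n ^ 2 / sqrt n"
    by real_asymp
  moreover have "\<forall>\<^sub>F n::nat in sequentially. 16 * sqrt (ln n) \<le> sqrt (n / (2 * ln n ^ 2))"
    by real_asymp
  moreover have "\<forall>\<^sub>F n::nat in sequentially. 4 * (sqrt n * ln n ^ 3 + 1) < n / (2 * ln n ^ 2)"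
    by real_asymp
  moreover have "\<forall>\<^sub>F n::nat in sequentially. 1 / n + 96 * sqrt (ln n) * (sqrt n * ln n ^ 3 + 1) /
      (n / (2 * ln n ^ 2) * sqrt (n / (2 * ln n ^ 2))) + 1 / n ^ 2 \<le> ln n ^ 7 / n"
    by real_asymp
  moreover have "\<forall>\<^sub>F n::nat in sequentially. sqrt n / ln n ^ 3 * (ln n ^ 2 / sqrt n) \<le> 3 / 4"
    by real_asymp
  moreover have "\<forall>\<^sub>F n::nat in sequentially. (3 * (n / ln n ^ 2) + 2 * (2 * ln n + 1) + 2 * (sqrt n / ln n ^ 3) + 2) * ln n + ln 2
      - (real n - 2 - (2 * ln n + 1) - n / ln n ^ 2) * ln (4 / 3) \<le> - ln n"
    by real_asymp
  \<comment> \<open>The exponent 6: averaging over coordinates costs \<open>n / s\<close>, of order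
    \<open>L ^ 2\<close>, and the square root of \<open>\<epsilon>\<close> costs
    \<open>L powr (7/2)\<close>, in total \<open>L powr (11/2)\<close>.\<close>
  moreover have "\<forall>\<^sub>F n::nat in sequentially. 1 / n + 2 * ln n ^ 2 * (1 / n + sqrt (1 / n + ln n ^ 7 / n)) \<le> ln n ^ 6 / sqrt n"
    by real_asymp
  moreover have "\<forall>\<^sub>F n::nat in sequentially. n / ln n ^ 2 + (2 * ln n + 1) + 3 \<le> n"
    by real_asymp
  moreover have "\<forall>\<^sub>F n::nat in sequentially. n / ln n ^ 2 \<ge> 2"
    by real_asymp
  moreover have "\<forall>\<^sub>F n::nat in sequentially. ln n \<ge> 1"
    by real_asymp
  moreover have "\<forall>\<^sub>F n::nat in sequentially. n \<ge> 3"
    by (rule eventually_ge_at_top)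
  moreover note eventually_prime_between_power2
  ultimately show ?thesis
  proof eventually_elim
    case (elim n)
    note asym = elim(1-10) and n3 = elim(11)
    define L where "L = ln (real n)"
    define \<rho> where "\<rho> = L ^ 2 / sqrt n"
    define \<epsilon> where "\<epsilon> = L ^ 7 / n"
    define s where "s = nat \<lfloor>n / L ^ 2\<rfloor>"
    define t where "t = nat \<lceil>sqrt n * L ^ 3\<rceil>"
    define q where "q = n div t"
    define K where "K = nat \<lceil>log 2 n\<rceil>"
    obtain p where p: "prime p" "n < p" "p \<le> n ^ 2" using elim(12) by blast
    have odd: "odd p" using prime_odd_nat[OF p(1)] p(2) n3 by simp
    have L1: "L \<ge> 1" using asym(10) by (simp add: L_def)
    have n0: "real n > 0" using n3 by simp
    have t1: "sqrt n * L ^ 3 \<le> t" and t2: "t \<le> sqrt n * L ^ 3 + 1"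
    proof -
      have "sqrt n * L ^ 3 \<ge> 0" using L1 by simp
      then show "sqrt n * L ^ 3 \<le> t" "t \<le> sqrt n * L ^ 3 + 1" unfolding t_def by linarith+
    qed
    \<comment> \<open>Since \<open>n / L ^ 2 \<ge> 2\<close>, rounding down loses at most a factor
      of two.\<close>
    have s1: "s \<le> n / L ^ 2" and s2: "n / (2 * L ^ 2) \<le> s"
    proof -
      have "n / L ^ 2 \<ge> 2" using asym(9) by (simp add: L_def)
      moreover have "n / (2 * L ^ 2) = (n / L ^ 2) / 2" by simp
      ultimately show "s \<le> n / L ^ 2" "n / (2 * L ^ 2) \<le> s" unfolding s_def by linarith+
    qed
    have sp: "n / (2 * L ^ 2) > 0" using n0 L1 by simp
    have s0: "s > 0" using s2 sp by linarith
    have K1: "2 ^ K \<ge> n" and K2: "K \<le> 2 * L + 1"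
    proof -
      have l0: "log 2 n \<ge> 0" using n3 by simp
      have "real n = 2 powr log 2 n" using n3 by simp
      also have "\<dots> \<le> 2 powr real K" using l0 unfolding K_def by (intro powr_mono) linarith+
      also have "\<dots> = real (2 ^ K)" by (simp add: powr_realpow)
      finally show "2 ^ K \<ge> n" by (simp only: of_nat_le_iff)
      have "log 2 n = L / ln 2" by (simp add: log_def L_def)
      also have "\<dots> \<le> 2 * L"
      proof -
        have "L * 1 \<le> L * (2 * ln 2)" using L1 ln2_ge_two_thirds by (intro mult_left_mono) auto
        then show ?thesis by (simp add: field_simps)
      qed
      finally show "K \<le> 2 * L + 1" using l0 unfolding K_def by linarith
    qed
    have t0: "t > 0"
    proof -
      have "sqrt n * L ^ 3 > 0" using n0 L1 by simp
      then show ?thesis using t1 by linarith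
    qed
    have q1: "real q \<le> sqrt n / L ^ 3"
    proof -
      have "q * t \<le> n" by (simp add: q_def)
      then have "real q * t \<le> n" by (metis of_nat_le_iff of_nat_mult)
      moreover have "real q * (sqrt n * L ^ 3) \<le> real q * t" using t1 by (intro mult_left_mono) auto
      ultimately have "real q * L ^ 3 * sqrt n \<le> sqrt n * sqrt n" by (simp add: mult_ac)
      then have "real q * L ^ 3 \<le> sqrt n" using n0 by (subst (asm) mult_le_cancel_right_pos) auto
      then show ?thesis using L1 by (simp add: field_simps)
    qed
    have q2: "q \<le> p" using p(2) unfolding q_def by (meson div_le_dividend le_trans less_imp_le_nat)
    have q3: "n < Suc q * t"
      using t0 unfolding q_def by (simp add: dividend_less_div_times add.commute)
    have sum: "s + K + 3 \<le> n"
    proof -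
      have "real s + real K + 3 \<le> n" using asym(8) s1 K2 unfolding L_def by linarith
      then have "real (s + K + 3) \<le> real n" by simp
      then show ?thesis by (simp only: of_nat_le_iff)
    qed
    have \<rho>0: "\<rho> \<ge> 0" and \<epsilon>0: "\<epsilon> \<ge> 0" using L1 by (auto simp: \<rho>_def \<epsilon>_def)
    have q\<rho>: "q * \<rho> \<le> 3 / 4"
    proof -
      have "q * \<rho> \<le> sqrt n / L ^ 3 * \<rho>" using q1 \<rho>0 by (intro mult_right_mono)
      also have "\<dots> \<le> 3 / 4" using asym(5) by (simp add: \<rho>_def L_def)
      finally show ?thesis .
    qed
    \<comment> \<open>The radius \<open>2 * sqrt L\<close> is chosen so that the Gaussian tail
      \<open>exp (- r\<^sup>2 / 2)\<close> equals \<open>1 / n ^ 2\<close>.\<close>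
    have r: "2 * sqrt L > 0" "8 * (2 * sqrt L) \<le> sqrt s"
    proof -
      show "2 * sqrt L > 0" using L1 by simp
      have "sqrt (n / (2 * L ^ 2)) \<le> sqrt s" using s2 by (rule real_sqrt_le_mono)
      then show "8 * (2 * sqrt L) \<le> sqrt s" using asym(2) unfolding L_def by linarith
    qed
    have er: "exp (- ((2 * sqrt L)\<^sup>2) / 2) = 1 / real n ^ 2"
    proof -
      have "exp (- ((2 * sqrt L)\<^sup>2) / 2) = exp (- (L + L))" using L1 by (simp add: power_mult_distrib)
      also have "\<dots> = 1 / real n ^ 2"
        unfolding exp_minus exp_add using n0 by (simp add: L_def power2_eq_square field_simps)
      finally show ?thesis .
    qed
    have pn: "1 / real p \<le> 1 / n" using p(2) n0 by (intro divide_left_mono) auto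
    have nonzero: "fourier_bound p C w \<le> \<rho>"
      if C: "finite C" "card C = s" "\<And>j. j \<in> C \<Longrightarrow> \<not> int p dvd w j" for C w
    proof -
      have "fourier_bound p C w \<le> 1 / p + 12 * (2 * sqrt L) / sqrt s + 1 / real n ^ 2"
        using fourier_bound_nonzero_le[OF p(1) odd C(1) _ C(3) r(1)] r(2) s0 er C(2) by simp
      moreover have "12 * (2 * sqrt L) / sqrt s \<le> 24 * sqrt L / sqrt (n / (2 * L ^ 2))"
      proof -
        have "24 * sqrt L / sqrt s \<le> 24 * sqrt L / sqrt (n / (2 * L ^ 2))"
          using s2 sp L1 by (intro divide_left_mono real_sqrt_le_mono mult_pos_pos) auto
        then show ?thesis by simp
      qed
      ultimately show ?thesis using asym(1) pn unfolding \<rho>_def L_def by linarith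
    qed
    have coinc: "fourier_bound p C w \<le> \<epsilon>"
      if C: "finite C" "card C = s" "card {x \<in> C \<times> C. int p dvd w (fst x) - w (snd x)} \<le> s * t" for C w
    proof -
      have c: "real (card {x \<in> C \<times> C. int p dvd w (fst x) - w (snd x)}) \<le> card C * real t"
        using C(3) unfolding C(2) of_nat_mult[symmetric] of_nat_le_iff .
      have "4 * real t \<le> 4 * (sqrt n * L ^ 3 + 1)" using t2 by simp
      also have "\<dots> < n / (2 * L ^ 2)" using asym(3) unfolding L_def .
      also note s2
      finally have "4 * real t < card C" unfolding C(2) .
      then have "fourier_bound p C w \<le> 1 / p + 48 * (2 * sqrt L) * t / (s * sqrt s) + 1 / real n ^ 2"
        using fourier_bound_few_coincidences_le[OF p(1) odd C(1) _ c _ r(1)] r(2) s0 er C(2) by simp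
      moreover have "48 * (2 * sqrt L) * t / (s * sqrt s) \<le>
          96 * sqrt L * (sqrt n * L ^ 3 + 1) / (n / (2 * L ^ 2) * sqrt (n / (2 * L ^ 2)))"
      proof (rule frac_le)
        show "0 \<le> 96 * sqrt L * (sqrt n * L ^ 3 + 1)" using L1 by simp
        show "48 * (2 * sqrt L) * t \<le> 96 * sqrt L * (sqrt n * L ^ 3 + 1)"
          using mult_left_mono[OF t2, of "96 * sqrt L"] L1 by simp
        show "0 < n / (2 * L ^ 2) * sqrt (n / (2 * L ^ 2))" using sp by (intro mult_pos_pos) auto
        show "n / (2 * L ^ 2) * sqrt (n / (2 * L ^ 2)) \<le> s * sqrt s"
          using s2 sp by (intro mult_mono real_sqrt_le_mono) auto
      qed
      ultimately show ?thesis using asym(4) pn unfolding \<epsilon>_def L_def by linarith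
    qed
    have bad: "real (card (bad_mats n p D E s \<epsilon>)) \<le> 1 / n * card (sym_signs n)"
      if D: "D \<subseteq> {..<n}" and E: "E \<subseteq> D" and cE: "n \<le> card E + 1 + K" and cD: "card (D - E) \<le> K" for D E
    proof -
      have "finite D" using D finite_subset by blast
      then have "card E \<le> card {..<n}" using D E by (intro card_mono) auto
      then have En: "card E \<le> n" by simp
      define e where "e = n - 2 - K - s"
      have e: "e + 2 + K + s = n" using sum by (simp add: e_def)
      have er: "real e = real n - 2 - real K - real s" using e by linarith
      have "real (card (bad_mats n p D E s \<epsilon>)) \<le> real (card E ^ s * p ^ (card (D - E) + s)) *
          (p * (3/4) ^ (card E - 1) + real (p ^ q) * (q * \<rho>) ^ (card E - s)) * card (sym_signs n)"
      proof (rule order_trans[OF card_bad_mats_le[OF p(1) odd D E _ q2 _ \<rho>0 nonzero coinc]])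
        show "s \<le> card E" using sum cE by linarith
        show "card E < Suc q * t" using En q3 by linarith
      qed auto
      also have "\<dots> \<le> 1 / n * card (sym_signs n)"
      proof (rule mult_right_mono)
        have "real (card E ^ s * p ^ (card (D - E) + s)) *
          (p * (3/4) ^ (card E - 1) + real p ^ q * (q * \<rho>) ^ (card E - s))
          \<le> exp ((3 * s + 2 * K + 2 * q + 2) * ln n + ln 2 - e * ln (4 / 3))"
          using n3 p prime_gt_0_nat[OF p(1)] by (intro union_bound_le[OF _ _ _ En cE cD e \<rho>0 q\<rho>]) auto
        also have "\<dots> \<le> exp (- ln n)"
        proof -
          have "(3 * s + 2 * K + 2 * q + 2) * L \<le> (3 * (n / L ^ 2) + 2 * (2 * L + 1) + 2 * (sqrt n / L ^ 3) + 2) * L"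
            using s1 K2 q1 L1 by (intro mult_right_mono) auto
          moreover have "(real n - 2 - (2 * L + 1) - n / L ^ 2) * ln (4 / 3) \<le> e * ln (4 / 3)"
            unfolding er using s1 K2 by (intro mult_right_mono) auto
          ultimately show ?thesis using asym(6) unfolding L_def exp_le_cancel_iff by linarith
        qed
        also have "\<dots> = 1 / n" using n0 by (simp add: exp_minus field_simps)
        finally show "real (card E ^ s * p ^ (card (D - E) + s)) *
          (p * (3/4) ^ (card E - 1) + real (p ^ q) * (q * \<rho>) ^ (card E - s)) \<le> 1 / n" by simp
      qed auto
      finally show ?thesis .
    qed
    \<comment> \<open>Besides \<open>i\<close>, each \<open>E i\<close> omits \<open>K\<close>
      indices, the coordinates reserved for decoupling; \<open>2 ^ K \<ge> n\<close> makes the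
      diagonal term at most \<open>1 / n\<close>.\<close>
    have "\<exists>E. E \<subseteq> {..<n} - {i} \<and> card E = n - 1 - K" if "i < n" for i
    proof -
      have "n - 1 - K \<le> card ({..<n} - {i})" using that by simp
      then show ?thesis using obtain_subset_with_card_n by metis
    qed
    then obtain E where E: "\<And>i. i < n \<Longrightarrow> E i \<subseteq> {..<n} - {i}" "\<And>i. i < n \<Longrightarrow> card (E i) = n - 1 - K" by metis
    have EK: "card ({..<n} - {i} - E i) = K" if "i < n" for i
    proof -
      have "card ({..<n} - {i} - E i) = card ({..<n} - {i}) - card (E i)"
        using E(1)[OF that] by (intro card_Diff_subset) (auto intro: finite_subset)
      then show ?thesis using E(2)[OF that] that sum by simp
    qed
    have N0: "real (card (sym_signs n)) > 0"
      using bij_betw_same_card[OF bij_betw_sym_signs_mats, of n] sym_sign_mats_nonempty[of n] finite_sym_sign_mats[of n]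
      by (simp add: card_gt_0_iff)
    have "real (card {M \<in> sym_signs n. \<exists>v\<in>kernel_mod n p M. \<exists>j<n. \<not> int p dvd v j})
        \<le> (1 / n + n / s * (1 / n + sqrt (1 / 2 ^ K + \<epsilon>))) * card (sym_signs n)"
    proof (rule card_singular_mod_le[OF p(1) odd s0 \<epsilon>0 E(1) EK])
      show "real (card (bad_mats n p {..<n} {..<n} s \<epsilon>)) \<le> 1 / n * card (sym_signs n)"
        by (intro bad) auto
      show "real (card (bad_mats n p ({..<n} - {i}) (E i) s \<epsilon>)) \<le> 1 / n * card (sym_signs n)" if "i < n" for i
        using E(1)[OF that] E(2)[OF that] EK[OF that] sum by (intro bad) auto
    qed auto
    then have "card {M \<in> sym_signs n. \<exists>v\<in>kernel_mod n p M. \<exists>j<n. \<not> int p dvd v j} / card (sym_signs n)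
        \<le> 1 / n + n / s * (1 / n + sqrt (1 / 2 ^ K + \<epsilon>))"
      using N0 by (simp add: pos_divide_le_eq)
    with singular_prob_le[OF p(1), of n]
    have "singular_prob n \<le> 1 / n + n / s * (1 / n + sqrt (1 / 2 ^ K + \<epsilon>))" by linarith
    also have "\<dots> \<le> 1 / n + 2 * L ^ 2 * (1 / n + sqrt (1 / n + L ^ 7 / n))"
    proof (intro add_left_mono mult_mono)
      show "n / s \<le> 2 * L ^ 2" using s2 s0 L1 by (simp add: field_simps)
      have "1 / 2 ^ K \<le> 1 / real n"
      proof (rule divide_left_mono)
        have "real n \<le> real (2 ^ K)" using K1 by (simp only: of_nat_le_iff)
        then show "real n \<le> 2 ^ K" by simp
      qed (use n0 in auto)
      then show "sqrt (1 / 2 ^ K + \<epsilon>) \<le> sqrt (1 / n + L ^ 7 / n)" by (simp add: \<epsilon>_def)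
    qed (use \<epsilon>0 in auto)
    also have "\<dots> \<le> L ^ 6 / sqrt n" using asym(7) by (simp add: L_def)
    finally show ?case by (simp add: L_def)
  qed
qed

theorem theorem1p1:
  shows "\<exists>C::real. C > 0 \<and>
    singular_prob \<in> O(\<lambda>n. ln (real n) powr C / real n powr (1/2))"
proof (intro exI conjI)
  show "singular_prob \<in> O(\<lambda>n. ln (real n) powr 6 / real n powr (1/2))"
  proof (rule bigoI[where c = 1])
    show "\<forall>\<^sub>F n in sequentially. norm (singular_prob n) \<le> 1 * norm (ln (real n) powr 6 / real n powr (1/2))"
      using eventually_singular_prob_le eventually_ge_at_top[of 2]
    proof eventually_elim
      case (elim n)
      then have "ln (real n) > 0" by simp
      then have "ln (real n) powr 6 = ln (real n) ^ 6" by (simp add: powr_numeral)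
      moreover have "real n powr (1/2) = sqrt n" by (simp add: powr_half_sqrt)
      moreover have "singular_prob n \<ge> 0" by (simp add: singular_prob_def)
      ultimately show ?case using elim by simp
    qed
  qed
qed simp

end
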